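(* Let $\mathcal{E}$ be an infinite dimensional Hilbert space and let $T\in B(\mathcal{E})$ be of defect form with $\dim E_1(T)=\dim E_{-1}(T)+1$ or $\dim E_1(T)=\dim E_{-1}(T)-1$. Then there exists an irreducible BCL pair $(V_1,V_2)$ on $H^2_{\mathcal{E}}(\mathbb{D})$ whose defect operator has non-zero part equal to $T$; that is, there exist a unitary $U$ and a projection $P$ on $\mathcal{E}$ with no common reducing subspace other than $\{0\}$ and $\mathcal{E}$ such that $P^\perp-UP^\perp U^*=T$.
   Context: All Hilbert spaces are complex and separable; "projection" means orthogonal projection and $P^\perp=I-P$. $H^2(\mathbb{D})$ is the Hardy space of the open unit disc, $M_z$ is multiplication by $z$, $P_{\mathbb{C}}$ is the projection of $H^2(\mathbb{D})$ onto the constants, and $H^2_{\mathcal{E}}(\mathbb{D})$ is identified with $H^2(\mathbb{D})\otimes\mathcal{E}$. A BCL triple is $(\mathcal{E},U,P)$ with $U$ unitary and $P$ a projection on $\mathcal{E}$; its BCL pair is $V_1=(I\otimes P+M_z\otimes P^\perp)(I\otimes U^* )$, $V_2=(I\otimes U)(M_z\otimes P+I\otimes P^\perp)$. The BCL pair is irreducible if $U$ and $P$ have no common reducing subspace other than $\{0\}$ and $\mathcal{E}$. The defect operator is $C(V_1,V_2)=I-V_1V_1^*-V_2V_2^*+V_1V_2V_1^*V_2^*=P_{\mathbb{C}}\otimes(P^\perp-UP^\perp U^* )$; "its non-zero part equals $T$" means $\overline{\operatorname{ran}}\,C(V_1,V_2)=\mathbb{C}\otimes\mathcal{E}$ and $C(V_1,V_2)|_{\mathbb{C}\otimes\mathcal{E}}=T$,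 i.e. $P^\perp-UP^\perp U^*=T$. $E_\mu(T)=\ker(T-\mu I)$. $T\in B(\mathcal{E})$ is of defect form if $T$ is compact, self-adjoint, injective, $\|T\|\le1$, and for every $\lambda\in(0,1)$, $\lambda$ is an eigenvalue of $T$ iff $-\lambda$ is, with $\dim E_\lambda(T)=\dim E_{-\lambda}(T)$; then $\mathcal{E}$ is the orthogonal direct sum of the eigenspaces of $T$. *)

theory Defs
  imports "HOL-Analysis.Analysis"
begin

class complex_vector = real_vector +
  fixes scaleC :: "complex \<Rightarrow> 'a \<Rightarrow> 'a" (infixr \<open>*\<^sub>C\<close> 75)
  assumes scaleC_add_right: "a *\<^sub>C (x + y) = a *\<^sub>C x + a *\<^sub>C y"
    and scaleC_add_left: "(a + b) *\<^sub>C x = a *\<^sub>C x + b *\<^sub>C x"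
    and scaleC_scaleC: "a *\<^sub>C (b *\<^sub>C x) = (a * b) *\<^sub>C x"
    and scaleC_one: "1 *\<^sub>C x = x"
    and scaleR_scaleC: "scaleR r x = complex_of_real r *\<^sub>C x"

class complex_inner = complex_vector + real_normed_vector +
  fixes cinner :: "'a \<Rightarrow> 'a \<Rightarrow> complex"
  assumes cinner_commute: "cinner x y = cnj (cinner y x)"
    and cinner_add_left: "cinner (x + y) z = cinner x z + cinner y z"
    and cinner_scaleC_left: "cinner (r *\<^sub>C x) y = cnj r * cinner x y"
    and cinner_real: "Im (cinner x x) = 0"
    and cinner_ge_zero: "0 \<le> Re (cinner x x)"
    and cinner_eq_zero_iff: "cinner x x = 0 \<longleftrightarrow> x = 0"
    and norm_eq_sqrt_cinner: "norm x = sqrt (Re (cinner x x))"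

class chilbert_space = complex_inner + complete_space

definition csubspace :: "'a::complex_vector set \<Rightarrow> bool" where
  "csubspace M \<longleftrightarrow> 0 \<in> M \<and> (\<forall>x\<in>M. \<forall>y\<in>M. x + y \<in> M) \<and> (\<forall>c. \<forall>x\<in>M. c *\<^sub>C x \<in> M)"

definition cspan :: "'a::complex_vector set \<Rightarrow> 'a set" where
  "cspan S = csubspace hull S"

definition cdim :: "'a::complex_vector set \<Rightarrow> enat" where
  "cdim M = (if \<exists>B. finite B \<and> cspan B = M
             then enat (LEAST n. \<exists>B. finite B \<and> card B = n \<and> cspan B = M)
             else \<infinity>)"

definition clinear :: "('a::complex_vector \<Rightarrow> 'b::complex_vector) \<Rightarrow> bool" where
  "clinear f \<longleftrightarrow> (\<forall>x y. f (x + y) = f x + f y) \<and> (\<forall>c x. f (c *\<^sub>C x) = c *\<^sub>C f x)"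

definition cblinear :: "('a::complex_inner \<Rightarrow> 'a) \<Rightarrow> bool" where
  "cblinear f \<longleftrightarrow> clinear f \<and> (\<exists>K. \<forall>x. norm (f x) \<le> norm x * K)"

definition cadj :: "('a::complex_inner \<Rightarrow> 'a) \<Rightarrow> ('a \<Rightarrow> 'a)" where
  "cadj T = (SOME S. \<forall>x y. cinner (T x) y = cinner x (S y))"

definition unitary_op :: "('a::complex_inner \<Rightarrow> 'a) \<Rightarrow> bool" where
  "unitary_op U \<longleftrightarrow> cblinear U \<and> U \<circ> cadj U = id \<and> cadj U \<circ> U = id"

definition cprojection :: "('a::complex_inner \<Rightarrow> 'a) \<Rightarrow> bool" where
  "cprojection P \<longleftrightarrow> cblinear P \<and> P \<circ> P = P \<and> cadj P = P"

definition corth :: "'a::complex_inner set \<Rightarrow> 'a set" where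
  "corth M = {y. \<forall>x\<in>M. cinner x y = 0}"

definition reducing_subspace :: "'a::complex_inner set \<Rightarrow> ('a \<Rightarrow> 'a) \<Rightarrow> bool" where
  "reducing_subspace M A \<longleftrightarrow> csubspace M \<and> closed M \<and> A ` M \<subseteq> M \<and> A ` corth M \<subseteq> corth M"

definition no_common_reducing :: "('a::complex_inner \<Rightarrow> 'a) \<Rightarrow> ('a \<Rightarrow> 'a) \<Rightarrow> bool" where
  "no_common_reducing U P \<longleftrightarrow>
     (\<forall>M. reducing_subspace M U \<and> reducing_subspace M P \<longrightarrow> M = {0} \<or> M = UNIV)"

definition compact_op :: "('a::complex_inner \<Rightarrow> 'a) \<Rightarrow> bool" where
  "compact_op T \<longleftrightarrow> cblinear T \<and> compact (closure (T ` cball 0 1))"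

definition eigenspace :: "complex \<Rightarrow> ('a::complex_vector \<Rightarrow> 'a) \<Rightarrow> 'a set" where
  "eigenspace \<mu> T = {x. T x = \<mu> *\<^sub>C x}"

definition is_eigenvalue :: "complex \<Rightarrow> ('a::complex_vector \<Rightarrow> 'a) \<Rightarrow> bool" where
  "is_eigenvalue \<mu> T \<longleftrightarrow> eigenspace \<mu> T \<noteq> {0}"

definition defect_form :: "('a::complex_inner \<Rightarrow> 'a) \<Rightarrow> bool" where
  "defect_form T \<longleftrightarrow> compact_op T \<and> cadj T = T \<and> inj T \<and> (\<forall>x. norm (T x) \<le> norm x) \<and>
     (\<forall>l::real. 0 < l \<and> l < 1 \<longrightarrow>
        (is_eigenvalue (complex_of_real l) T \<longleftrightarrow> is_eigenvalue (complex_of_real (- l)) T) \<and>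
        cdim (eigenspace (complex_of_real l) T) = cdim (eigenspace (complex_of_real (- l)) T))"

end

theory Submission
  imports Defs
begin

text \<open>Let \<open>Q\<close> be the complement of \<open>P\<close>; we need \<open>Q - U Q U\<^sup>* = T\<close>. Say that eigenvalue \<open>1\<close> has the larger
  multiplicity, with orthonormal eigenvectors \<open>u\<^sub>0, \<dots>, u\<^sub>m\<close>, let \<open>w\<^sub>0, \<dots>, w\<^bsub>m-1\<^esub>\<close> be those for \<open>- 1\<close>, and pair
  the remaining ones as \<open>e\<^sub>j, e'\<^sub>j\<close> for \<open>\<lambda>\<^sub>j, - \<lambda>\<^sub>j\<close>. In the plane of \<open>e\<^sub>j, e'\<^sub>j\<close> put \<open>f = a e + b e'\<close>,
  \<open>h = b e - a e'\<close>, \<open>g = b e + a e'\<close>, \<open>k = a e - b e'\<close> with \<open>a\<^sup>2 + b\<^sup>2 = 1\<close>, \<open>a\<^sup>2 - b\<^sup>2 = \<lambda>\<^sub>j\<close>. Then \<open>T\<close> is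
  the difference of the projections onto the closed spans of \<open>{u\<^sub>i, f\<^sub>j}\<close> and of \<open>{w\<^sub>i, g\<^sub>j}\<close>. A unitary \<open>U\<close>
  carries the first onto the second and acts as a shift:
  \<open>u\<^sub>0 \<mapsto> g\<^sub>0\<close>, \<open>u\<^bsub>i+1\<^esub> \<mapsto> w\<^sub>i\<close>, \<open>f\<^sub>j \<mapsto> g\<^bsub>j+1\<^esub>\<close>, \<open>h\<^sub>i \<mapsto> u\<^sub>i\<close> for \<open>i \<le> m\<close>, \<open>h\<^bsub>i+1\<^esub> \<mapsto> k\<^sub>i\<close> for \<open>i \<ge> m\<close>, and
  \<open>w\<^sub>i \<mapsto> k\<^sub>i\<close>. A common reducing subspace reduces \<open>T\<close>. The vectors of \<open>ker (T - 1)\<close> that \<open>U\<close> maps into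
  \<open>ker (T\<^sup>2 - \<lambda>\<^sub>0\<^sup>2)\<close> are the multiples of \<open>u\<^sub>0\<close>, so \<open>u\<^sub>0\<close> lies in the subspace or in its complement,
  and from \<open>u\<^sub>0\<close> the operators \<open>U\<close>, \<open>U\<^sup>*\<close>, \<open>Q\<close> generate the whole eigenbasis.\<close>

subsection \<open>Complex inner product spaces\<close>

lemma cinner_add_right: "cinner x (y + z) = cinner x y + cinner x (z::'a::complex_inner)"
  by (metis cinner_add_left cinner_commute complex_cnj_add)

lemma cinner_scaleC_right: "cinner x (r *\<^sub>C y) = r * cinner x (y::'a::complex_inner)"
  by (metis cinner_scaleC_left cinner_commute complex_cnj_mult complex_cnj_cnj)

lemma scaleC_0 [simp]: "0 *\<^sub>C x = (0::'a::complex_vector)"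
  by (metis of_real_0 scaleR_scaleC scale_zero_left)

lemma scaleC_0_right [simp]: "c *\<^sub>C 0 = (0::'a::complex_vector)"
  by (metis add_cancel_right_right scaleC_add_right)

lemma scaleC_1 [simp]: "1 *\<^sub>C x = (x::'a::complex_vector)"
  by (rule scaleC_one)

lemma scaleC_minus_left: "(- c) *\<^sub>C x = - (c *\<^sub>C (x::'a::complex_vector))"
  by (metis ab_left_minus eq_neg_iff_add_eq_0 scaleC_0 scaleC_add_left)

lemma scaleC_minus_right: "c *\<^sub>C (- x) = - (c *\<^sub>C (x::'a::complex_vector))"
  by (metis ab_left_minus eq_neg_iff_add_eq_0 scaleC_0_right scaleC_add_right)

lemma scaleC_diff_right: "c *\<^sub>C (x - y) = c *\<^sub>C x - c *\<^sub>C (y::'a::complex_vector)"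
  by (metis scaleC_add_right scaleC_minus_right diff_conv_add_uminus)

lemma scaleC_diff_left: "(a - b) *\<^sub>C x = a *\<^sub>C x - b *\<^sub>C (x::'a::complex_vector)"
  by (metis scaleC_add_left scaleC_minus_left diff_conv_add_uminus)

lemma cinner_0_left [simp]: "cinner 0 (x::'a::complex_inner) = 0"
  by (metis cinner_scaleC_left complex_cnj_zero mult_zero_left scaleC_0)

lemma cinner_0_right [simp]: "cinner (x::'a::complex_inner) 0 = 0"
  by (metis cinner_commute cinner_0_left complex_cnj_zero)

lemma cinner_minus_left: "cinner (- x) (y::'a::complex_inner) = - cinner x y"
  by (metis add.right_inverse cinner_0_left cinner_add_left eq_neg_iff_add_eq_0 add.commute)

lemma cinner_minus_right: "cinner x (- (y::'a::complex_inner)) = - cinner x y"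
  by (metis cinner_commute cinner_minus_left complex_cnj_minus)

lemma cinner_diff_left: "cinner (x - y) (z::'a::complex_inner) = cinner x z - cinner y z"
  by (metis cinner_add_left cinner_minus_left diff_conv_add_uminus)

lemma cinner_diff_right: "cinner z (x - (y::'a::complex_inner)) = cinner z x - cinner z y"
  by (metis cinner_add_right cinner_minus_right diff_conv_add_uminus)

lemma cinner_sum_right: "cinner x (sum f F) = (\<Sum>i\<in>F. cinner x (f i :: 'a::complex_inner))"
  by (induction F rule: infinite_finite_induct) (auto simp: cinner_add_right)

lemma cinner_sum_left: "cinner (sum f F) x = (\<Sum>i\<in>F. cinner (f i :: 'a::complex_inner) x)"
  by (induction F rule: infinite_finite_induct) (auto simp: cinner_add_left)

lemmas cinner_simps = cinner_add_left cinner_add_right cinner_scaleC_left cinner_scaleC_right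
  cinner_minus_left cinner_minus_right cinner_diff_left cinner_diff_right

lemma cinner_self: "cinner x x = complex_of_real ((norm (x::'a::complex_inner))\<^sup>2)"
  by (simp add: complex_eq_iff cinner_real norm_eq_sqrt_cinner cinner_ge_zero)

lemma cinner_commute_0: "cinner x y = 0 \<longleftrightarrow> cinner y (x::'a::complex_inner) = 0"
  by (metis cinner_commute complex_cnj_zero)

lemma cinner_ext: "(\<And>z. cinner z x = cinner z y) \<Longrightarrow> x = (y::'a::complex_inner)"
  by (metis cinner_diff_right cinner_eq_zero_iff diff_self right_minus_eq)

lemma norm_add_orth:
  assumes "cinner x (y::'a::complex_inner) = 0"
  shows "(norm (x + y))\<^sup>2 = (norm x)\<^sup>2 + (norm y)\<^sup>2"
proof -
  have "cinner y x = 0"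
    using assms cinner_commute_0 by blast
  then have "complex_of_real ((norm (x + y))\<^sup>2) = complex_of_real ((norm x)\<^sup>2 + (norm y)\<^sup>2)"
    unfolding cinner_self[symmetric] of_real_add using assms by (simp add: cinner_simps)
  then show ?thesis
    using of_real_eq_iff by blast
qed

lemma norm_scaleC: "norm (c *\<^sub>C (x::'a::complex_inner)) = cmod c * norm x"
proof -
  have "cinner (c *\<^sub>C x) (c *\<^sub>C x) = (c * cnj c) * cinner x x"
    by (simp add: cinner_simps mult_ac)
  also have "\<dots> = complex_of_real ((cmod c)\<^sup>2 * (norm x)\<^sup>2)"
    by (simp add: cinner_self complex_norm_square[symmetric])
  finally have "complex_of_real ((norm (c *\<^sub>C x))\<^sup>2) = complex_of_real ((cmod c * norm x)\<^sup>2)"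
    unfolding cinner_self[symmetric] by (simp only: power_mult_distrib)
  then have "(norm (c *\<^sub>C x))\<^sup>2 = (cmod c * norm x)\<^sup>2"
    using of_real_eq_iff by blast
  then show ?thesis
    by (simp add: power2_eq_iff_nonneg)
qed

text \<open>Subtracting from \<open>y\<close> its component along \<open>x\<close> leaves a vector
  orthogonal to \<open>x\<close>; Pythagoras then bounds that component by
  \<open>norm y\<close>.\<close>

lemma norm_cinner_le: "cmod (cinner x y) \<le> norm x * norm (y::'a::complex_inner)"
proof (cases "x = 0")
  case False
  define c where "c = cinner x y / cinner x x"
  define z where "z = y - c *\<^sub>C x"
  have n0: "cinner x x \<noteq> 0"
    using False cinner_eq_zero_iff by blast
  have "cinner x z = 0"
    unfolding z_def c_def using n0 by (simp add: cinner_simps)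
  then have "cinner (c *\<^sub>C x) z = 0"
    by (simp add: cinner_simps)
  from norm_add_orth[OF this] have "(norm y)\<^sup>2 = (norm (c *\<^sub>C x))\<^sup>2 + (norm z)\<^sup>2"
    by (simp add: z_def)
  then have "norm (c *\<^sub>C x) \<le> norm y"
    by (smt (verit) norm_ge_zero power_mono_iff zero_le_power2 zero_less_numeral)
  then have "cmod c * norm x * norm x \<le> norm y * norm x"
    by (simp add: norm_scaleC mult_right_mono)
  moreover have "cmod c * norm x * norm x = cmod (cinner x y)"
    using False by (simp add: c_def norm_divide cinner_self power2_eq_square norm_mult)
  ultimately show ?thesis
    by (simp add: mult.commute)
qed simp

lemma bounded_bilinear_cinner: "bounded_bilinear (cinner :: 'a::complex_inner \<Rightarrow> 'a \<Rightarrow> complex)"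
proof
  show "\<exists>K. \<forall>a b. norm (cinner a (b::'a)) \<le> norm a * norm b * K"
    by (rule exI[of _ 1]) (simp add: norm_cinner_le)
qed (simp_all add: cinner_simps scaleR_scaleC scaleR_conv_of_real)

lemma bounded_linear_cinner_left: "bounded_linear (\<lambda>x. cinner x (y::'a::complex_inner))"
  by (rule bounded_bilinear.bounded_linear_left[OF bounded_bilinear_cinner])

lemma bounded_linear_cinner_right: "bounded_linear (\<lambda>y. cinner x (y::'a::complex_inner))"
  by (rule bounded_bilinear.bounded_linear_right[OF bounded_bilinear_cinner])

lemma bounded_linear_scaleC: "bounded_linear (\<lambda>x. c *\<^sub>C (x::'a::complex_inner))"
  by (rule bounded_linear_intro[of _ "cmod c"])
    (simp_all add: scaleC_add_right scaleR_scaleC scaleC_scaleC mult.commute norm_scaleC)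

lemma closed_orth_vector: "closed {y. cinner x (y::'a::complex_inner) = 0}"
  by (rule closed_Collect_eq)
    (auto intro: linear_continuous_on bounded_linear_cinner_right)

lemma closed_corth: "closed (corth (M::'a::complex_inner set))"
proof -
  have "corth M = (\<Inter>x\<in>M. {y. cinner x y = 0})"
    by (auto simp: corth_def)
  then show ?thesis
    using closed_orth_vector by auto
qed

lemma csubspace_corth: "csubspace (corth (M::'a::complex_inner set))"
  by (auto simp: csubspace_def corth_def cinner_simps)

section \<open>Bounded operators and uniqueness of adjoints\<close>

lemma cblinear_bounded_linear: "cblinear f \<Longrightarrow> bounded_linear f"
  unfolding cblinear_def clinear_def
  by (auto intro!: bounded_linearI' simp: scaleR_scaleC)
    (metis bounded_linear_intro scaleR_scaleC)

lemma cblinear_add: "cblinear f \<Longrightarrow> f (x + y) = f x + f y"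
  and cblinear_scaleC: "cblinear f \<Longrightarrow> f (c *\<^sub>C x) = c *\<^sub>C f x"
  by (auto simp: cblinear_def clinear_def)

lemma cblinear_0: "cblinear f \<Longrightarrow> f 0 = 0"
  and cblinear_diff: "cblinear f \<Longrightarrow> f (x - y) = f x - f y"
  using bounded_linear.linear[OF cblinear_bounded_linear]
  by (blast intro: linear_0 linear_diff)+

lemma cblinear_compose: "cblinear f \<Longrightarrow> cblinear g \<Longrightarrow> cblinear (\<lambda>x. f (g x))"
  using bounded_linear.bounded[OF bounded_linear_compose[OF cblinear_bounded_linear cblinear_bounded_linear, of f g]]
  by (auto simp: cblinear_def clinear_def)

lemma cblinear_diff_fun: "cblinear f \<Longrightarrow> cblinear g \<Longrightarrow> cblinear (\<lambda>x. f x - g x)"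
  using bounded_linear.bounded[OF bounded_linear_sub[OF cblinear_bounded_linear cblinear_bounded_linear, of f g]]
  by (auto simp: cblinear_def clinear_def scaleC_diff_right)

lemma cblinear_id: "cblinear (\<lambda>x. x)"
  by (auto simp: cblinear_def clinear_def intro: exI[of _ 1])

text \<open>\<open>cadj\<close> is a choice among all operators satisfying the adjoint relation;
  nondegeneracy of \<open>cinner\<close> leaves only one.\<close>

lemma cadj_eqI:
  assumes "\<And>x y. cinner (A x) y = cinner x (B y)"
  shows "cadj A = B"
proof -
  have "\<forall>x y. cinner (A x) y = cinner x (cadj A y)"
    unfolding cadj_def by (rule someI[of _ B]) (simp add: assms)
  then show ?thesis
    using assms by (intro ext cinner_ext) metis
qed

subsection \<open>Orthonormal families and diagonal operators\<close>

definition orthonormal_on :: "'i set \<Rightarrow> ('i \<Rightarrow> 'a::complex_inner) \<Rightarrow> bool" where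
  "orthonormal_on I b \<longleftrightarrow> (\<forall>i\<in>I. \<forall>j\<in>I. cinner (b i) (b j) = (if i = j then 1 else 0))"

definition total_on :: "'i set \<Rightarrow> ('i \<Rightarrow> 'a::complex_inner) \<Rightarrow> bool" where
  "total_on I b \<longleftrightarrow> (\<forall>x. (\<forall>i\<in>I. cinner (b i) x = 0) \<longrightarrow> x = 0)"

text \<open>One device for several operators: with \<open>c = 1\<close> and two bases it is the
  unitary carrying \<open>b\<close> to \<open>b'\<close>, and with \<open>b = b'\<close> it is
  diagonal with entries \<open>c\<close>.\<close>

definition diag_op :: "'i set \<Rightarrow> ('i \<Rightarrow> complex) \<Rightarrow> ('i \<Rightarrow> 'a) \<Rightarrow> ('i \<Rightarrow> 'a) \<Rightarrow> 'a::complex_inner \<Rightarrow> 'a" where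
  "diag_op I c b b' x = (\<Sum>\<^sub>\<infinity>i\<in>I. (c i * cinner (b i) x) *\<^sub>C b' i)"

lemma norm_sum_orthonormal:
  assumes "orthonormal_on I b" "finite F" "F \<subseteq> I"
  shows "(norm (\<Sum>i\<in>F. c i *\<^sub>C b i))\<^sup>2 = (\<Sum>i\<in>F. (cmod (c i))\<^sup>2)"
  using assms(2,3)
proof (induction F rule: finite_induct)
  case (insert j F)
  have "cinner (c j *\<^sub>C b j) (\<Sum>i\<in>F. c i *\<^sub>C b i) = 0"
    using insert assms(1) by (auto simp: cinner_simps cinner_sum_right orthonormal_on_def intro!: sum.neutral)
  moreover have "norm (b j) = 1"
    using insert assms(1) cinner_self[of "b j"] norm_eq_sqrt_cinner[of "b j"] by (auto simp: orthonormal_on_def)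
  ultimately show ?case
    using insert by (simp add: norm_add_orth norm_scaleC)
qed simp

lemma orthonormal_residual:
  assumes "orthonormal_on I b" "finite F" "F \<subseteq> I" "j \<in> F"
  shows "cinner (b j) (x - (\<Sum>i\<in>F. cinner (b i) x *\<^sub>C b i)) = 0"
proof -
  have "cinner (b j) (\<Sum>i\<in>F. cinner (b i) x *\<^sub>C b i) = (\<Sum>i\<in>F. if i = j then cinner (b i) x else 0)"
    unfolding cinner_sum_right
    by (rule sum.cong) (use assms in \<open>auto simp: cinner_simps orthonormal_on_def subset_iff\<close>)
  then show ?thesis
    using assms by (simp add: cinner_simps)
qed

lemma bessel:
  assumes "orthonormal_on I b" "finite F" "F \<subseteq> I"
  shows "(\<Sum>i\<in>F. (cmod (cinner (b i) x))\<^sup>2) \<le> (norm x)\<^sup>2"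
proof -
  define s where "s = (\<Sum>i\<in>F. cinner (b i) x *\<^sub>C b i)"
  have "cinner (b j) (x - s) = 0" if "j \<in> F" for j
    unfolding s_def by (rule orthonormal_residual[OF assms that])
  then have "cinner s (x - s) = 0"
    unfolding s_def cinner_sum_left by (auto simp: cinner_scaleC_left intro!: sum.neutral)
  from norm_add_orth[OF this] have "(norm s)\<^sup>2 \<le> (norm x)\<^sup>2"
    by simp
  then show ?thesis
    unfolding s_def norm_sum_orthonormal[OF assms] .
qed

text \<open>Past a finite set \<open>F0\<close> whose square sum nearly reaches the supremum, any
  further terms have small norm by Pythagoras, so the net of finite partial sums is Cauchy.\<close>

lemma orthonormal_summable:
  fixes b :: "'i \<Rightarrow> 'a::chilbert_space"
  assumes on: "orthonormal_on I b"
    and bd: "\<And>F. finite F \<Longrightarrow> F \<subseteq> I \<Longrightarrow> (\<Sum>i\<in>F. (cmod (c i))\<^sup>2) \<le> K"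
  shows "(\<lambda>i. c i *\<^sub>C b i) summable_on I"
proof -
  define f where "f = (\<lambda>i. c i *\<^sub>C b i)"
  define g where "g = (\<lambda>i. (cmod (c i))\<^sup>2)"
  define S where "S = (SUP F\<in>{F. finite F \<and> F \<subseteq> I}. sum g F)"
  have bdd: "bdd_above (sum g ` {F. finite F \<and> F \<subseteq> I})"
    using bd by (auto simp: g_def bdd_above_def)
  let ?B = "filtermap (sum f) (finite_subsets_at_top I)"
  have "\<exists>P. eventually P (finite_subsets_at_top I) \<and> (\<forall>X Y. P X \<and> P Y \<longrightarrow> dist (sum f X) (sum f Y) < e)"
    if "e > 0" for e
  proof -
    define d where "d = (e/2)\<^sup>2"
    have "d > 0"
      using that by (simp add: d_def)
    then have "S - d < S"
      by simp
    then obtain F0 where F0: "finite F0" "F0 \<subseteq> I" "S - d < sum g F0"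
      unfolding S_def by (subst (asm) less_cSUP_iff) (use bdd in auto)
    have near: "dist (sum f X) (sum f F0) < e/2" if X: "finite X" "F0 \<subseteq> X" "X \<subseteq> I" for X
    proof -
      have "sum g X \<le> S"
        unfolding S_def using X bdd by (auto intro: cSUP_upper)
      moreover have "sum g X = sum g (X - F0) + sum g F0"
        using X by (simp add: sum.subset_diff)
      moreover have "sum f X = sum f (X - F0) + sum f F0"
        using X by (simp add: sum.subset_diff)
      moreover have "(norm (sum f (X - F0)))\<^sup>2 = sum g (X - F0)"
        unfolding f_def g_def using X by (intro norm_sum_orthonormal[OF on]) auto
      ultimately have "(norm (sum f (X - F0)))\<^sup>2 < (e/2)\<^sup>2"
        using F0 by (simp add: d_def)
      then have "norm (sum f (X - F0)) < e/2"
        using \<open>e > 0\<close> by (meson less_eq_real_def half_gt_zero power_less_imp_less_base)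
      then show ?thesis
        using \<open>sum f X = sum f (X - F0) + sum f F0\<close> by (simp add: dist_norm)
    qed
    show ?thesis
    proof (rule exI[of _ "\<lambda>X. finite X \<and> F0 \<subseteq> X \<and> X \<subseteq> I"], intro conjI allI impI)
      show "eventually (\<lambda>X. finite X \<and> F0 \<subseteq> X \<and> X \<subseteq> I) (finite_subsets_at_top I)"
        unfolding eventually_finite_subsets_at_top using F0 by blast
    next
      fix X Y assume "(finite X \<and> F0 \<subseteq> X \<and> X \<subseteq> I) \<and> (finite Y \<and> F0 \<subseteq> Y \<and> Y \<subseteq> I)"
      then show "dist (sum f X) (sum f Y) < e"
        using near[of X] near[of Y] dist_triangle2[of "sum f X" "sum f Y" "sum f F0"] by auto
    qed
  qed
  then have "cauchy_filter ?B"
    by (auto simp: cauchy_filter_metric_filtermap)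
  then obtain x where "?B \<le> nhds x"
    using cauchy_filter_complete_converges[of ?B UNIV] complete_UNIV[where 'a='a]
    by (auto simp: filtermap_bot_iff)
  then have "(f has_sum x) I"
    by (auto simp: has_sum_def filterlim_def)
  then show ?thesis
    by (auto simp: summable_on_def f_def)
qed

locale diag =
  fixes I :: "'i set" and c :: "'i \<Rightarrow> complex" and b b' :: "'i \<Rightarrow> 'a::chilbert_space"
  assumes on: "orthonormal_on I b" and on': "orthonormal_on I b'"
    and c_le: "\<And>i. i \<in> I \<Longrightarrow> cmod (c i) \<le> 1"
begin

lemma finite_le:
  assumes "finite F" "F \<subseteq> I"
  shows "(\<Sum>i\<in>F. (cmod (c i * cinner (b i) x))\<^sup>2) \<le> (norm x)\<^sup>2"
proof -
  have "(\<Sum>i\<in>F. (cmod (c i * cinner (b i) x))\<^sup>2) \<le> (\<Sum>i\<in>F. (cmod (cinner (b i) x))\<^sup>2)"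
  proof (rule sum_mono)
    fix i assume "i \<in> F"
    then have "cmod (c i) * cmod (cinner (b i) x) \<le> 1 * cmod (cinner (b i) x)"
      using c_le assms by (intro mult_right_mono) auto
    then show "(cmod (c i * cinner (b i) x))\<^sup>2 \<le> (cmod (cinner (b i) x))\<^sup>2"
      by (intro power_mono) (auto simp: norm_mult)
  qed
  also have "\<dots> \<le> (norm x)\<^sup>2"
    by (rule bessel[OF on assms])
  finally show ?thesis .
qed

lemma has_sum_diag_op: "((\<lambda>i. (c i * cinner (b i) x) *\<^sub>C b' i) has_sum diag_op I c b b' x) I"
  unfolding diag_op_def
  by (rule has_sum_infsum, rule orthonormal_summable[OF on', where K="(norm x)\<^sup>2"]) (rule finite_le)

text \<open>The continuous functional \<open>cinner (b' i)\<close> is applied termwise, and only the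
  term of index \<open>i\<close> survives.\<close>

lemma cinner_diag_op:
  assumes "i \<in> I"
  shows "cinner (b' i) (diag_op I c b b' x) = c i * cinner (b i) x"
proof -
  have "((\<lambda>j. cinner (b' i) ((c j * cinner (b j) x) *\<^sub>C b' j)) has_sum cinner (b' i) (diag_op I c b b' x)) I"
    by (rule has_sum_bounded_linear[OF bounded_linear_cinner_right has_sum_diag_op])
  moreover have "((\<lambda>j. cinner (b' i) ((c j * cinner (b j) x) *\<^sub>C b' j)) has_sum (c i * cinner (b i) x)) I"
  proof (rule has_sum_cong_neutral[THEN iffD1, rotated 3])
    show "((\<lambda>j. c j * cinner (b j) x) has_sum (c i * cinner (b i) x)) {i}"
      using has_sum_finite[of "{i}" "\<lambda>j. c j * cinner (b j) x"] by simp
  qed (use on' assms in \<open>auto simp: cinner_simps orthonormal_on_def\<close>)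
  ultimately show ?thesis
    by (rule has_sum_unique)
qed

lemma norm_diag_op_le: "norm (diag_op I c b b' x) \<le> norm x"
proof -
  have "((\<lambda>F. norm (\<Sum>i\<in>F. (c i * cinner (b i) x) *\<^sub>C b' i)) \<longlongrightarrow> norm (diag_op I c b b' x)) (finite_subsets_at_top I)"
    using has_sum_diag_op unfolding has_sum_def by (rule tendsto_norm)
  moreover have "\<forall>\<^sub>F F in finite_subsets_at_top I. norm (\<Sum>i\<in>F. (c i * cinner (b i) x) *\<^sub>C b' i) \<le> norm x"
  proof (rule eventually_finite_subsets_at_top_weakI)
    fix F assume "finite F" "F \<subseteq> I"
    then have "(norm (\<Sum>i\<in>F. (c i * cinner (b i) x) *\<^sub>C b' i))\<^sup>2 \<le> (norm x)\<^sup>2"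
      by (simp add: norm_sum_orthonormal[OF on'] finite_le)
    then show "norm (\<Sum>i\<in>F. (c i * cinner (b i) x) *\<^sub>C b' i) \<le> norm x"
      by (rule power2_le_imp_le) simp
  qed
  ultimately show ?thesis
    by (rule tendsto_upperbound) simp
qed

lemma cblinear_diag_op: "cblinear (diag_op I c b b')"
proof -
  have "diag_op I c b b' (x + y) = diag_op I c b b' x + diag_op I c b b' y" for x y
  proof -
    have "((\<lambda>i. (c i * cinner (b i) (x + y)) *\<^sub>C b' i) has_sum (diag_op I c b b' x + diag_op I c b b' y)) I"
      using has_sum_add[OF has_sum_diag_op[of x] has_sum_diag_op[of y]]
      by (simp add: cinner_simps distrib_left scaleC_add_left)
    then show ?thesis
      using has_sum_diag_op has_sum_unique by blast
  qed
  moreover have "diag_op I c b b' (r *\<^sub>C x) = r *\<^sub>C diag_op I c b b' x" for r x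
  proof -
    have "((\<lambda>i. (c i * cinner (b i) (r *\<^sub>C x)) *\<^sub>C b' i) has_sum (r *\<^sub>C diag_op I c b b' x)) I"
      using has_sum_bounded_linear[OF bounded_linear_scaleC[of r] has_sum_diag_op[of x]]
      by (simp add: cinner_simps scaleC_scaleC mult.left_commute)
    then show ?thesis
      using has_sum_diag_op has_sum_unique by blast
  qed
  ultimately show ?thesis
    unfolding cblinear_def clinear_def using norm_diag_op_le by (auto intro!: exI[of _ 1])
qed

lemma diag_op_basis:
  assumes "i \<in> I"
  shows "diag_op I c b b' (b i) = c i *\<^sub>C b' i"
proof -
  have "((\<lambda>j. (c j * cinner (b j) (b i)) *\<^sub>C b' j) has_sum (c i *\<^sub>C b' i)) I"
  proof (rule has_sum_cong_neutral[THEN iffD1, rotated 3])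
    show "((\<lambda>j. c j *\<^sub>C b' j) has_sum (c i *\<^sub>C b' i)) {i}"
      using has_sum_finite[of "{i}" "\<lambda>j. c j *\<^sub>C b' j"] by simp
  qed (use on assms in \<open>auto simp: orthonormal_on_def\<close>)
  then show ?thesis
    using has_sum_diag_op has_sum_unique by blast
qed

lemma diag_op_in_closed_csubspace:
  assumes "closed M" "csubspace M" "b' ` I \<subseteq> M"
  shows "diag_op I c b b' x \<in> M"
proof (rule Lim_in_closed_set[OF assms(1)])
  show "(sum (\<lambda>i. (c i * cinner (b i) x) *\<^sub>C b' i) \<longlongrightarrow> diag_op I c b b' x) (finite_subsets_at_top I)"
    using has_sum_diag_op unfolding has_sum_def .
  have "sum (\<lambda>i. (c i * cinner (b i) x) *\<^sub>C b' i) F \<in> M" if "finite F" "F \<subseteq> I" for F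
    using that by (induction F rule: finite_induct) (use assms in \<open>auto simp: csubspace_def\<close>)
  then show "\<forall>\<^sub>F F in finite_subsets_at_top I. sum (\<lambda>i. (c i * cinner (b i) x) *\<^sub>C b' i) F \<in> M"
    by (rule eventually_finite_subsets_at_top_weakI)
qed simp

end

text \<open>Both sides are sums of the same terms: moving the scalar across \<open>cinner\<close>
  conjugates it and interchanges the two families.\<close>

lemma diag_op_adjoint:
  fixes b b' :: "'i \<Rightarrow> 'a::chilbert_space"
  assumes "diag I c b b'"
  shows "cinner (diag_op I c b b' x) y = cinner x (diag_op I (\<lambda>i. cnj (c i)) b' b y)"
proof -
  interpret diag I c b b' by fact
  interpret d': diag I "\<lambda>i. cnj (c i)" b' b
    by unfold_locales (use on on' c_le in auto)
  have "((\<lambda>i. cinner ((c i * cinner (b i) x) *\<^sub>C b' i) y) has_sum cinner (diag_op I c b b' x) y) I"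
    by (rule has_sum_bounded_linear[OF bounded_linear_cinner_left has_sum_diag_op])
  moreover have "((\<lambda>i. cinner x ((cnj (c i) * cinner (b' i) y) *\<^sub>C b i)) has_sum cinner x (diag_op I (\<lambda>i. cnj (c i)) b' b y)) I"
    by (rule has_sum_bounded_linear[OF bounded_linear_cinner_right d'.has_sum_diag_op])
  moreover have "cinner ((c i * cinner (b i) x) *\<^sub>C b' i) y = cinner x ((cnj (c i) * cinner (b' i) y) *\<^sub>C b i)" for i
    by (simp add: cinner_simps cinner_commute[of x] mult_ac)
  ultimately show ?thesis
    using has_sum_unique by fastforce
qed

lemma total_on_eqI:
  "total_on I b \<Longrightarrow> (\<And>i. i \<in> I \<Longrightarrow> cinner (b i) x = cinner (b i) y) \<Longrightarrow> x = y"
  unfolding total_on_def by (metis cinner_diff_right right_minus_eq)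

lemma diag_op_1_self:
  fixes b :: "'i \<Rightarrow> 'a::chilbert_space"
  assumes "orthonormal_on I b" "total_on I b"
  shows "diag_op I (\<lambda>_. 1) b b x = x"
proof -
  interpret diag I "\<lambda>_. 1" b b
    by unfold_locales (use assms in auto)
  show ?thesis
    by (rule total_on_eqI[OF assms(2)]) (simp add: cinner_diag_op)
qed

text \<open>Every vector is the sum of its expansion in the family, and bounded operators pass
  through that sum.\<close>

lemma cblinear_eq_on_basis:
  fixes b :: "'i \<Rightarrow> 'a::chilbert_space"
  assumes "orthonormal_on I b" "total_on I b" "cblinear f" "cblinear g"
    and eq: "\<And>i. i \<in> I \<Longrightarrow> f (b i) = g (b i)"
  shows "f x = g x"
proof -
  interpret diag I "\<lambda>_. 1" b b
    by unfold_locales (use assms in auto)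
  have s: "((\<lambda>i. cinner (b i) x *\<^sub>C b i) has_sum x) I"
    using has_sum_diag_op[of x] by (simp add: diag_op_1_self[OF assms(1,2)])
  have "((\<lambda>i. f (cinner (b i) x *\<^sub>C b i)) has_sum f x) I" "((\<lambda>i. g (cinner (b i) x *\<^sub>C b i)) has_sum g x) I"
    using has_sum_bounded_linear[OF cblinear_bounded_linear s] assms(3,4) by blast+
  moreover have "f (cinner (b i) x *\<^sub>C b i) = g (cinner (b i) x *\<^sub>C b i)" if "i \<in> I" for i
    using eq[OF that] assms(3,4) by (simp add: cblinear_scaleC)
  ultimately show ?thesis
    using has_sum_cong has_sum_unique by (metis (no_types, lifting))
qed

lemma unitary_of_bases:
  fixes b b' :: "'i \<Rightarrow> 'a::chilbert_space"
  assumes "orthonormal_on I b" "total_on I b" "orthonormal_on I b'" "total_on I b'"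
  defines "U \<equiv> diag_op I (\<lambda>_. 1) b b'"
  shows "unitary_op U" "cadj U = diag_op I (\<lambda>_. 1) b' b"
proof -
  interpret diag I "\<lambda>_. 1" b b'
    by unfold_locales (use assms in auto)
  interpret d': diag I "\<lambda>_. 1" b' b
    by unfold_locales (use assms in auto)
  show adj: "cadj U = diag_op I (\<lambda>_. 1) b' b"
    unfolding U_def using diag_op_adjoint[OF diag_axioms] by (intro cadj_eqI) simp
  show "unitary_op U"
    unfolding unitary_op_def adj
    using assms cblinear_diag_op
    by (auto simp: U_def fun_eq_iff cinner_diag_op d'.cinner_diag_op intro: total_on_eqI[of I b] total_on_eqI[of I b'])
qed

subsection \<open>Orthogonal decomposition and adjoints\<close>

text \<open>Zorn's lemma: two elements of the union of a chain already lie in one member, so the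
  union is again orthonormal.\<close>

lemma maximal_orthonormal_set:
  fixes M :: "'a::complex_inner set"
  obtains B where "B \<subseteq> M" "orthonormal_on B id"
    "\<And>C. B \<subseteq> C \<Longrightarrow> C \<subseteq> M \<Longrightarrow> orthonormal_on C id \<Longrightarrow> C = B"
proof -
  let ?A = "{B. B \<subseteq> M \<and> orthonormal_on B id}"
  have "\<exists>B\<in>?A. \<forall>X\<in>?A. B \<subseteq> X \<longrightarrow> X = B"
  proof (rule subset_Zorn')
    fix C assume C: "subset.chain ?A C"
    then have "\<Union>C \<subseteq> M"
      by (auto simp: subset.chain_def)
    moreover have "cinner x y = (if x = y then 1 else 0)" if xy: "x \<in> \<Union>C" "y \<in> \<Union>C" for x y
    proof -
      obtain X Y where XY: "X \<in> C" "Y \<in> C" "x \<in> X" "y \<in> Y"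
        using xy by blast
      with C have "X \<subseteq> Y \<or> Y \<subseteq> X"
        by (meson subset_chain_def)
      with XY have "\<exists>Z\<in>C. x \<in> Z \<and> y \<in> Z"
        by blast
      with C show ?thesis
        by (auto simp: subset.chain_def orthonormal_on_def)
    qed
    ultimately show "\<Union>C \<in> ?A"
      by (auto simp: orthonormal_on_def)
  qed
  then obtain B where B: "B \<in> ?A" "\<forall>X\<in>?A. B \<subseteq> X \<longrightarrow> X = B"
    by (rule bexE)
  show thesis
  proof (rule that)
    show "B \<subseteq> M" "orthonormal_on B id"
      using B(1) by simp_all
    show "C = B" if "B \<subseteq> C" "C \<subseteq> M" "orthonormal_on C id" for C
      using B(2) that by simp
  qed
qed

text \<open>A non-zero \<open>x\<close> could be normalised and added to \<open>B\<close>.\<close>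

lemma maximal_orthonormal_orth:
  fixes M :: "'a::complex_inner set"
  assumes M: "csubspace M" and on: "orthonormal_on B id"
    and "B \<subseteq> M" and max: "\<And>C. B \<subseteq> C \<Longrightarrow> C \<subseteq> M \<Longrightarrow> orthonormal_on C id \<Longrightarrow> C = B"
    and x: "x \<in> M" and orth: "\<And>e. e \<in> B \<Longrightarrow> cinner e x = 0"
  shows "x = 0"
proof (rule ccontr)
  assume "x \<noteq> 0"
  define y where "y = complex_of_real (1 / norm x) *\<^sub>C x"
  have y: "y \<in> M" "cinner y y = 1"
    using M x \<open>x \<noteq> 0\<close> by (auto simp: y_def csubspace_def cinner_self norm_scaleC norm_divide)
  have yB: "cinner e y = 0" "cinner y e = 0" if "e \<in> B" for e
    using orth[OF that] cinner_commute_0[of y e] by (auto simp: y_def cinner_simps)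
  have "orthonormal_on (insert y B) id"
    using on y yB by (auto simp: orthonormal_on_def)
  then have "y \<in> B"
    using max[of "insert y B"] y \<open>B \<subseteq> M\<close> by blast
  with yB y show False
    by fastforce
qed

text \<open>The component in \<open>M\<close> is the expansion in a maximal orthonormal subset of
  \<open>M\<close>; by maximality the expansion reproduces every vector of \<open>M\<close>.\<close>

lemma orthogonal_decomposition:
  fixes M :: "'a::chilbert_space set"
  assumes "csubspace M" "closed M"
  obtains p q where "p \<in> M" "q \<in> corth M" "x = p + q"
proof -
  obtain B where B: "B \<subseteq> M" "orthonormal_on B id"
    and max: "\<And>C. B \<subseteq> C \<Longrightarrow> C \<subseteq> M \<Longrightarrow> orthonormal_on C id \<Longrightarrow> C = B"
    using maximal_orthonormal_set by blast
  interpret diag B "\<lambda>_. 1" id id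
    by unfold_locales (use B in auto)
  define P where "P = diag_op B (\<lambda>_. 1) id id"
  have PM: "P y \<in> M" for y
    unfolding P_def by (rule diag_op_in_closed_csubspace) (use assms B in auto)
  have PB: "cinner e (y - P y) = 0" if "e \<in> B" for e y
    using cinner_diag_op[OF that, of y] by (simp add: P_def cinner_simps)
  have "y = P y" if "y \<in> M" for y
  proof -
    have "y - P y \<in> M"
      using that PM[of y] assms(1) unfolding csubspace_def
      by (metis diff_conv_add_uminus scaleC_minus_left scaleC_1)
    then have "y - P y = 0"
      using maximal_orthonormal_orth[OF assms(1) B(2,1) max] PB by blast
    then show ?thesis
      by simp
  qed
  moreover have "cinner (P y) (x - P x) = 0" for y
  proof -
    \<comment> \<open>\<open>P\<close> is its own adjoint, and it annihilates the residual because
      all coefficients of the residual vanish.\<close>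
    have "diag_op B (\<lambda>i. cnj 1) id id (x - P x) = 0"
      unfolding diag_op_def by (rule infsum_0) (use PB in auto)
    then show ?thesis
      unfolding P_def diag_op_adjoint[OF diag_axioms] by simp
  qed
  ultimately have "x - P x \<in> corth M"
    unfolding corth_def mem_Collect_eq by metis
  then show thesis
    using that[of "P x" "x - P x"] PM by simp
qed

text \<open>Riesz representation: a non-zero bounded functional is given by a vector
  \<open>q\<close> orthogonal to its kernel, since modulo the kernel every \<open>x\<close> is a
  multiple of \<open>q\<close>.\<close>

lemma adjoint_exists:
  fixes A :: "'a::chilbert_space \<Rightarrow> 'a"
  assumes "cblinear A"
  shows "cinner (A x) y = cinner x (cadj A y)"
proof -
  have "\<exists>z. \<forall>x. cinner (A x) y = cinner x z" for y
  proof -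
    \<comment> \<open>\<open>cinner\<close> is conjugate-linear in its first argument, so the
      functional is linear with \<open>A x\<close> in the second.\<close>
    define M where "M = {x. cinner y (A x) = 0}"
    have "bounded_linear (\<lambda>x. cinner y (A x))"
      by (rule bounded_linear_compose[OF bounded_linear_cinner_right cblinear_bounded_linear[OF assms]])
    then have "closed M"
      unfolding M_def by (intro closed_Collect_eq linear_continuous_on continuous_on_const)
    have M: "csubspace M"
      unfolding M_def csubspace_def using assms
      by (auto simp: cblinear_add cblinear_scaleC cblinear_0 cinner_simps)
    show ?thesis
    proof (cases "M = UNIV")
      case True
      then have "cinner (A x) y = 0" for x
        using cinner_commute_0[of "A x" y] unfolding M_def by blast
      then show ?thesis
        by (intro exI[of _ 0]) simp
    next
      case False
      then obtain w where "w \<notin> M"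
        by blast
      obtain p q where "p \<in> M" and q: "q \<in> corth M" and "w = p + q"
        using orthogonal_decomposition[OF M \<open>closed M\<close>] by metis
      with \<open>w \<notin> M\<close> M have nz: "cinner y (A q) \<noteq> 0"
        unfolding csubspace_def M_def by blast
      then have "q \<noteq> 0"
        using assms cblinear_0 by fastforce
      define z where "z = (cinner (A q) y / cinner q q) *\<^sub>C q"
      have "cinner (A x) y = cinner x z" for x
      proof -
        define t where "t = cinner y (A x) / cinner y (A q)"
        have "x - t *\<^sub>C q \<in> M"
          using nz assms by (simp add: M_def t_def cblinear_diff cblinear_scaleC cinner_simps)
        then have 0: "cinner (x - t *\<^sub>C q) q = 0"
          using q by (auto simp: corth_def)
        then have xq: "cinner x q = cnj t * cinner q q"
          by (simp add: cinner_simps)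
        have ct: "cnj t = cinner (A x) y / cinner (A q) y"
          unfolding t_def using cinner_commute by (metis complex_cnj_divide)
        have "cinner (A q) y \<noteq> 0"
          using nz cinner_commute_0 by blast
        moreover have "cinner q q \<noteq> 0"
          using \<open>q \<noteq> 0\<close> cinner_eq_zero_iff by blast
        ultimately show ?thesis
          unfolding z_def cinner_scaleC_right xq ct by simp
      qed
      then show ?thesis
        by blast
    qed
  qed
  then have "\<exists>S. \<forall>x y. cinner (A x) y = cinner x (S y)"
    by metis
  then have "\<forall>x y. cinner (A x) y = cinner x (cadj A y)"
    unfolding cadj_def by (rule someI_ex)
  then show ?thesis
    by blast
qed

lemma corth_Int_0: "x \<in> M \<Longrightarrow> x \<in> corth M \<Longrightarrow> x = (0::'a::complex_inner)"
  by (simp add: corth_def cinner_eq_zero_iff[symmetric])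

lemma csubspace_diff: "csubspace M \<Longrightarrow> x \<in> M \<Longrightarrow> y \<in> M \<Longrightarrow> x - y \<in> M"
  unfolding csubspace_def by (metis diff_conv_add_uminus scaleC_minus_left scaleC_1)

lemma csubspace_add: "csubspace M \<Longrightarrow> x \<in> M \<Longrightarrow> y \<in> M \<Longrightarrow> x + y \<in> M"
  and csubspace_scaleC: "csubspace M \<Longrightarrow> x \<in> M \<Longrightarrow> c *\<^sub>C x \<in> M"
  by (auto simp: csubspace_def)

lemma csubspace_scaleC_iff: "csubspace M \<Longrightarrow> c \<noteq> 0 \<Longrightarrow> c *\<^sub>C x \<in> M \<longleftrightarrow> x \<in> M"
  using csubspace_scaleC[of M "c *\<^sub>C x" "inverse c"] csubspace_scaleC[of M x c]
  by (auto simp: scaleC_scaleC)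

lemma cprojection_complement:
  fixes P :: "'a::chilbert_space \<Rightarrow> 'a"
  assumes "cprojection P"
  shows "cprojection (\<lambda>x. x - P x)"
proof -
  have P: "cblinear P" "P (P x) = P x" "cadj P = P" for x
    using assms by (auto simp: cprojection_def fun_eq_iff)
  then have "cinner (P x) y = cinner x (P y)" for x y
    using adjoint_exists by metis
  then have "cadj (\<lambda>x. x - P x) = (\<lambda>x. x - P x)"
    by (intro cadj_eqI) (simp add: cinner_simps)
  then show ?thesis
    using P by (auto simp: cprojection_def fun_eq_iff cblinear_diff intro!: cblinear_diff_fun cblinear_id)
qed

lemma cprojection_diag_op:
  fixes b :: "'i \<Rightarrow> 'a::chilbert_space"
  assumes "orthonormal_on I b" "total_on I b" "\<And>i. c i \<in> {0, 1}"
  shows "cprojection (diag_op I c b b)"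
proof -
  have c: "cmod (c i) \<le> 1" "cnj (c i) = c i" "c i * (c i * z) = c i * z" for i z
    using assms(3)[of i] by auto
  interpret diag I c b b
    by unfold_locales (use assms c in auto)
  have "diag_op I c b b (diag_op I c b b x) = diag_op I c b b x" for x
    by (rule total_on_eqI[OF assms(2)]) (simp add: cinner_diag_op c)
  moreover have "cadj (diag_op I c b b) = diag_op I c b b"
    using diag_op_adjoint[OF diag_axioms] by (intro cadj_eqI) (simp add: c)
  ultimately show ?thesis
    by (auto simp: cprojection_def cblinear_diag_op)
qed

subsection \<open>The irreducible pair of a paired eigenbasis\<close>

text \<open>Labels for an orthonormal eigenbasis of \<open>T\<close>: \<open>IU i\<close> with \<open>i \<le> m\<close> for eigenvalue \<open>1\<close>, \<open>IW i\<close> with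
  \<open>i < m\<close> for eigenvalue \<open>- 1\<close>, and \<open>IP j\<close>, \<open>IM j\<close> for eigenvalues \<open>\<lambda>\<^sub>j\<close> and \<open>- \<lambda>\<^sub>j\<close>, where
  \<open>0 < \<lambda>\<^sub>j < 1\<close>.\<close>

datatype ix = IU nat | IW nat | IP nat | IM nat

definition ixs :: "nat \<Rightarrow> ix set" where
  "ixs m = IU ` {..m} \<union> IW ` {..<m} \<union> range IP \<union> range IM"

lemma ixs_simps [simp]:
  "IU i \<in> ixs m \<longleftrightarrow> i \<le> m" "IW i \<in> ixs m \<longleftrightarrow> i < m" "IP i \<in> ixs m" "IM i \<in> ixs m"
  by (auto simp: ixs_def)

text \<open>The labels form one two-sided chain: \<open>IM k\<close> with \<open>k > m\<close>
  descends to \<open>IM m\<close>; each \<open>IM i\<close> with \<open>i \<le> m\<close> goes to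
  \<open>IU i\<close>, which for \<open>i > 0\<close> continues through \<open>IW (i - 1)\<close> to
  \<open>IM (i - 1)\<close>; and \<open>IU 0\<close> opens the ray
  \<open>IP 0, IP 1, \<dots>\<close>.\<close>

fun shift :: "nat \<Rightarrow> ix \<Rightarrow> ix" where
  "shift m (IU 0) = IP 0"
| "shift m (IU (Suc i)) = IW i"
| "shift m (IP j) = IP (Suc j)"
| "shift m (IM i) = (if i \<le> m then IU i else IM (i - 1))"
| "shift m (IW i) = IM i"

lemma bij_betw_shift: "bij_betw (shift m) (ixs m) (ixs m)"
proof (rule bij_betwI')
  fix x y assume xy: "x \<in> ixs m" "y \<in> ixs m"
  show "(shift m x = shift m y) = (x = y)"
  proof
    assume "shift m x = shift m y"
    then show "x = y"
      using xy by (cases "(m, x)" rule: shift.cases; cases "(m, y)" rule: shift.cases) (auto split: if_splits)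
  qed simp
next
  fix x assume "x \<in> ixs m"
  then show "shift m x \<in> ixs m"
    by (cases "(m, x)" rule: shift.cases) auto
next
  fix y assume y: "y \<in> ixs m"
  show "\<exists>x\<in>ixs m. y = shift m x"
  proof (cases y)
    case (IU i)
    then show ?thesis
      using y by (intro bexI[of _ "IM i"]) auto
  next
    case (IW i)
    then show ?thesis
      using y by (intro bexI[of _ "IU (Suc i)"]) auto
  next
    case (IP j)
    show ?thesis
    proof (cases j)
      case 0
      then show ?thesis
        using IP by (intro bexI[of _ "IU 0"]) auto
    next
      case (Suc k)
      then show ?thesis
        using IP by (intro bexI[of _ "IP k"]) auto
    qed
  next
    case (IM k)
    show ?thesis
    proof (cases "k < m")
      case True
      then show ?thesis
        using IM by (intro bexI[of _ "IW k"]) auto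
    next
      case False
      then show ?thesis
        using IM by (intro bexI[of _ "IM (Suc k)"]) auto
    qed
  qed
qed

text \<open>In the plane of \<open>E (IP j)\<close> and \<open>E (IM j)\<close> this is the
  symmetric matrix with rows \<open>(p, q)\<close> and \<open>(q, - p)\<close>, a reflection when
  \<open>(p, q)\<close> lies on the unit circle.\<close>

definition rot :: "(ix \<Rightarrow> 'a::complex_inner) \<Rightarrow> (nat \<Rightarrow> real) \<Rightarrow> (nat \<Rightarrow> real) \<Rightarrow> ix \<Rightarrow> 'a" where
  "rot E p q i = (case i of
     IP j \<Rightarrow> complex_of_real (p j) *\<^sub>C E (IP j) + complex_of_real (q j) *\<^sub>C E (IM j)
   | IM j \<Rightarrow> complex_of_real (q j) *\<^sub>C E (IP j) - complex_of_real (p j) *\<^sub>C E (IM j)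
   | _ \<Rightarrow> E i)"

lemma rot_simps [simp]:
  "rot E p q (IU i) = E (IU i)" "rot E p q (IW i) = E (IW i)"
  "rot E p q (IP j) = complex_of_real (p j) *\<^sub>C E (IP j) + complex_of_real (q j) *\<^sub>C E (IM j)"
  "rot E p q (IM j) = complex_of_real (q j) *\<^sub>C E (IP j) - complex_of_real (p j) *\<^sub>C E (IM j)"
  by (auto simp: rot_def)

lemma of_real_unit_circle:
  assumes "(p::real)\<^sup>2 + q\<^sup>2 = 1"
  shows "complex_of_real p * complex_of_real p + complex_of_real q * complex_of_real q = 1"
  using assms unfolding power2_eq_square of_real_mult[symmetric] of_real_add[symmetric] by simp

text \<open>The reflection is its own inverse, so the same coefficients lead back.\<close>

lemma rot_inverse:
  assumes "(p j)\<^sup>2 + (q j)\<^sup>2 = 1"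
  shows "E (IP j) = complex_of_real (p j) *\<^sub>C rot E p q (IP j) + complex_of_real (q j) *\<^sub>C rot E p q (IM j)"
    and "E (IM j) = complex_of_real (q j) *\<^sub>C rot E p q (IP j) - complex_of_real (p j) *\<^sub>C rot E p q (IM j)"
proof -
  let ?p = "complex_of_real (p j)" and ?q = "complex_of_real (q j)"
  have pq: "?p * ?p + ?q * ?q = 1"
    by (rule of_real_unit_circle[OF assms])
  have "?p *\<^sub>C rot E p q (IP j) + ?q *\<^sub>C rot E p q (IM j)
      = (?p * ?p + ?q * ?q) *\<^sub>C E (IP j) + (?p * ?q - ?q * ?p) *\<^sub>C E (IM j)"
    by (simp add: scaleC_add_right scaleC_diff_right scaleC_scaleC scaleC_add_left scaleC_diff_left mult.commute)
  then show "E (IP j) = ?p *\<^sub>C rot E p q (IP j) + ?q *\<^sub>C rot E p q (IM j)"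
    unfolding pq by simp
  have "?q *\<^sub>C rot E p q (IP j) - ?p *\<^sub>C rot E p q (IM j)
      = (?q * ?p - ?p * ?q) *\<^sub>C E (IP j) + (?p * ?p + ?q * ?q) *\<^sub>C E (IM j)"
    by (simp add: scaleC_add_right scaleC_diff_right scaleC_scaleC scaleC_add_left scaleC_diff_left mult.commute)
  then show "E (IM j) = ?q *\<^sub>C rot E p q (IP j) - ?p *\<^sub>C rot E p q (IM j)"
    unfolding pq by simp
qed

lemma orthonormal_on_rot:
  assumes "orthonormal_on (ixs m) E" and pq: "\<And>j. (p j)\<^sup>2 + (q j)\<^sup>2 = 1"
  shows "orthonormal_on (ixs m) (rot E p q)"
proof -
  have E: "cinner (E i) (E j) = (if i = j then 1 else 0)" if "i \<in> ixs m" "j \<in> ixs m" for i j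
    using assms(1) that by (auto simp: orthonormal_on_def)
  note sq = of_real_unit_circle[OF pq]
  show ?thesis
    unfolding orthonormal_on_def
  proof (intro ballI)
    fix i j assume "i \<in> ixs m" "j \<in> ixs m"
    then show "cinner (rot E p q i) (rot E p q j) = (if i = j then 1 else 0)"
      using sq by (cases i; cases j) (auto simp: cinner_simps E algebra_simps)
  qed
qed

lemma total_on_rot:
  assumes "total_on (ixs m) E" and pq: "\<And>j. (p j)\<^sup>2 + (q j)\<^sup>2 = 1"
  shows "total_on (ixs m) (rot E p q)"
  unfolding total_on_def
proof (intro allI impI)
  fix x assume *: "\<forall>i\<in>ixs m. cinner (rot E p q i) x = 0"
  have "cinner (E i) x = 0" if "i \<in> ixs m" for i
  proof (cases i)
    case (IU k)
    then show ?thesis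
      using bspec[OF * that] by simp
  next
    case (IW k)
    then show ?thesis
      using bspec[OF * that] by simp
  next
    case (IP j)
    then show ?thesis
      by (subst IP, subst rot_inverse(1)[of p j q, OF pq])
        (simp only: cinner_simps bspec[OF *] ixs_simps mult_zero_right add_0)
  next
    case (IM j)
    then show ?thesis
      by (subst IM, subst rot_inverse(2)[of p j q, OF pq])
        (simp only: cinner_simps bspec[OF *] ixs_simps mult_zero_right diff_self)
  qed
  then show "x = 0"
    using assms(1) by (simp add: total_on_def)
qed

lemma orthonormal_on_reindex:
  "orthonormal_on I b \<Longrightarrow> bij_betw p I I \<Longrightarrow> orthonormal_on I (\<lambda>i. b (p i))"
  unfolding orthonormal_on_def using bij_betwE inj_on_eq_iff[OF bij_betw_imp_inj_on] by metis

lemma total_on_reindex: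
  "total_on I b \<Longrightarrow> bij_betw p I I \<Longrightarrow> total_on I (\<lambda>i. b (p i))"
  unfolding total_on_def by (metis bij_betw_iff_bijections)

section \<open>The unitary, the projection and their defect operator\<close>

locale paired_eigenbasis =
  fixes T :: "'a::chilbert_space \<Rightarrow> 'a" and E :: "ix \<Rightarrow> 'a" and lam :: "nat \<Rightarrow> real" and m :: nat
  assumes T: "cblinear T"
    and on: "orthonormal_on (ixs m) E" and total: "total_on (ixs m) E"
    and lam: "\<And>j. 0 < lam j" "\<And>j. lam j < 1"
    and T_IU: "\<And>i. i \<le> m \<Longrightarrow> T (E (IU i)) = E (IU i)"
    and T_IW: "\<And>i. i < m \<Longrightarrow> T (E (IW i)) = - E (IW i)"
    and T_IP: "\<And>j. T (E (IP j)) = complex_of_real (lam j) *\<^sub>C E (IP j)"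
    and T_IM: "\<And>j. T (E (IM j)) = - (complex_of_real (lam j) *\<^sub>C E (IM j))"
begin

abbreviation "I \<equiv> ixs m"

text \<open>\<open>a\<^sup>2 + b\<^sup>2 = 1\<close> and \<open>a\<^sup>2 - b\<^sup>2 = \<lambda>\<close>, so that in the plane of an eigenvalue pair \<open>\<plusminus> \<lambda>\<close> the projections
  onto \<open>(a, b)\<close> and \<open>(b, a)\<close> differ by \<open>diag(\<lambda>, - \<lambda>)\<close>.\<close>

definition a :: "nat \<Rightarrow> real" where "a j = sqrt ((1 + lam j) / 2)"
definition b :: "nat \<Rightarrow> real" where "b j = sqrt ((1 - lam j) / 2)"

lemma a_nz: "a j \<noteq> 0" and b_nz: "b j \<noteq> 0"
  using lam[of j] by (auto simp: a_def b_def)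

lemma a2: "(a j)\<^sup>2 = (1 + lam j) / 2" and b2: "(b j)\<^sup>2 = (1 - lam j) / 2"
  using lam[of j] by (auto simp: a_def b_def)

lemma ab: "(a j)\<^sup>2 + (b j)\<^sup>2 = 1" and ba: "(b j)\<^sup>2 + (a j)\<^sup>2 = 1" 
  by (simp_all add: a2 b2 field_simps)

lemma of_real_ab:
  "complex_of_real (a j) * complex_of_real (a j) - complex_of_real (b j) * complex_of_real (b j) = complex_of_real (lam j)"
proof -
  have "a j * a j - b j * b j = lam j"
    using a2[of j] b2[of j] by (simp add: power2_eq_square field_simps)
  then show ?thesis
    by (metis of_real_diff of_real_mult)
qed

text \<open>\<open>F\<close> will diagonalise \<open>Q\<close>, and \<open>G\<close> its conjugate
  \<open>Q'\<close>. In each plane \<open>F\<close> consists of the vectors \<open>f, h\<close> and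
  \<open>G\<close> of \<open>g, k\<close>; outside the planes both agree with
  \<open>E\<close>.\<close>

definition F :: "ix \<Rightarrow> 'a" where "F = rot E a b"
definition G :: "ix \<Rightarrow> 'a" where "G = rot E b a"

lemma on_F: "orthonormal_on I F" and total_F: "total_on I F"
  and on_G: "orthonormal_on I G" and total_G: "total_on I G"
  unfolding F_def G_def
  using orthonormal_on_rot[OF on] total_on_rot[OF total] ab ba by auto

definition G' :: "ix \<Rightarrow> 'a" where "G' i = G (shift m i)"

lemma on_G': "orthonormal_on I G'" and total_G': "total_on I G'"
  using orthonormal_on_reindex[OF on_G bij_betw_shift] total_on_reindex[OF total_G bij_betw_shift]
  by (simp_all add: G'_def[abs_def])

definition U :: "'a \<Rightarrow> 'a" where "U = diag_op I (\<lambda>_. 1) F G'"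

definition cQ :: "ix \<Rightarrow> complex" where
  "cQ i = (case i of IU _ \<Rightarrow> 1 | IP _ \<Rightarrow> 1 | _ \<Rightarrow> 0)"

definition cQ' :: "ix \<Rightarrow> complex" where
  "cQ' i = (case i of IW _ \<Rightarrow> 1 | IP _ \<Rightarrow> 1 | _ \<Rightarrow> 0)"

definition Q :: "'a \<Rightarrow> 'a" where "Q = diag_op I cQ F F"

lemma unitary_U: "unitary_op U" and cadj_U: "cadj U = diag_op I (\<lambda>_. 1) G' F"
  unfolding U_def using unitary_of_bases[OF on_F total_F on_G' total_G'] by auto

lemma cblinear_U: "cblinear U"
  using unitary_U by (simp add: unitary_op_def)

lemma cinner_U: "cinner (U x) y = cinner x (cadj U y)"
  by (rule adjoint_exists[OF cblinear_U])

sublocale dU: diag I "\<lambda>_. 1" F G'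
  by unfold_locales (use on_F on_G' in auto)

sublocale dU': diag I "\<lambda>_. 1" G' F
  by unfold_locales (use on_F on_G' in auto)

sublocale dQ: diag I cQ F F
  by unfold_locales (use on_F in \<open>auto simp: cQ_def split: ix.splits\<close>)

lemma cblinear_cadj_U: "cblinear (cadj U)"
  unfolding cadj_U by (rule dU'.cblinear_diag_op)

lemma cprojection_Q: "cprojection Q"
  unfolding Q_def by (rule cprojection_diag_op[OF on_F total_F]) (auto simp: cQ_def split: ix.splits)

lemma cblinear_Q: "cblinear Q"
  using cprojection_Q by (simp add: cprojection_def)

lemma U_F: "i \<in> I \<Longrightarrow> U (F i) = G (shift m i)"
  unfolding U_def by (simp add: dU.diag_op_basis G'_def)

lemma Q_F: "i \<in> I \<Longrightarrow> Q (F i) = cQ i *\<^sub>C F i"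
  unfolding Q_def by (rule dQ.diag_op_basis)

definition Q' :: "'a \<Rightarrow> 'a" where "Q' x = U (Q (cadj U x))"

lemma cblinear_Q': "cblinear Q'"
  unfolding Q'_def[abs_def] by (rule cblinear_compose[OF cblinear_U cblinear_compose[OF cblinear_Q cblinear_cadj_U]])

text \<open>Each \<open>G i\<close> is \<open>U (F k)\<close> with \<open>i = shift m k\<close>, and
  \<open>shift\<close> takes the labels \<open>IU\<close>, \<open>IP\<close> onto \<open>IW\<close>,
  \<open>IP\<close>, which turns the indicator \<open>cQ\<close> into \<open>cQ'\<close>.\<close>

lemma Q'_G:
  assumes "i \<in> I"
  shows "Q' (G i) = cQ' i *\<^sub>C G i"
proof -
  obtain k where k: "k \<in> I" "i = shift m k"
    using bij_betw_shift[of m] assms by (metis bij_betw_iff_bijections)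
  have "cadj U (G' k) = F k"
    unfolding cadj_U using dU'.diag_op_basis[OF k(1)] by simp
  then have "Q' (G i) = cQ k *\<^sub>C G i"
    using k by (simp add: Q'_def G'_def Q_F U_F cblinear_scaleC[OF cblinear_U])
  moreover have "cQ k = cQ' i"
    using k by (cases "(m, k)" rule: shift.cases) (auto simp: cQ_def cQ'_def split: if_splits)
  ultimately show ?thesis
    by simp
qed

lemma Q_E:
  "i \<le> m \<Longrightarrow> Q (E (IU i)) = E (IU i)"
  "i < m \<Longrightarrow> Q (E (IW i)) = 0"
  "Q (E (IP j)) = complex_of_real (a j) *\<^sub>C F (IP j)"
  "Q (E (IM j)) = complex_of_real (b j) *\<^sub>C F (IP j)"
proof -
  note lin = cblinear_scaleC[OF cblinear_Q] cblinear_add[OF cblinear_Q] cblinear_diff[OF cblinear_Q]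
  show "i \<le> m \<Longrightarrow> Q (E (IU i)) = E (IU i)"
    using Q_F[of "IU i"] by (simp add: F_def cQ_def)
  show "i < m \<Longrightarrow> Q (E (IW i)) = 0"
    using Q_F[of "IW i"] by (simp add: F_def cQ_def)
  show "Q (E (IP j)) = complex_of_real (a j) *\<^sub>C F (IP j)"
    unfolding rot_inverse(1)[of a j b E, OF ab] F_def[symmetric] lin
    by (simp add: Q_F cQ_def)
  show "Q (E (IM j)) = complex_of_real (b j) *\<^sub>C F (IP j)"
    unfolding rot_inverse(2)[of a j b E, OF ab] F_def[symmetric] lin
    by (simp add: Q_F cQ_def)
qed

lemma Q'_E:
  "i \<le> m \<Longrightarrow> Q' (E (IU i)) = 0"
  "i < m \<Longrightarrow> Q' (E (IW i)) = E (IW i)"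
  "Q' (E (IP j)) = complex_of_real (b j) *\<^sub>C G (IP j)"
  "Q' (E (IM j)) = complex_of_real (a j) *\<^sub>C G (IP j)"
proof -
  note lin = cblinear_scaleC[OF cblinear_Q'] cblinear_add[OF cblinear_Q'] cblinear_diff[OF cblinear_Q']
  show "i \<le> m \<Longrightarrow> Q' (E (IU i)) = 0"
    using Q'_G[of "IU i"] by (simp add: G_def cQ'_def)
  show "i < m \<Longrightarrow> Q' (E (IW i)) = E (IW i)"
    using Q'_G[of "IW i"] by (simp add: G_def cQ'_def)
  show "Q' (E (IP j)) = complex_of_real (b j) *\<^sub>C G (IP j)"
    unfolding rot_inverse(1)[of b j a E, OF ba] G_def[symmetric] lin
    by (simp add: Q'_G cQ'_def)
  show "Q' (E (IM j)) = complex_of_real (a j) *\<^sub>C G (IP j)"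
    unfolding rot_inverse(2)[of b j a E, OF ba] G_def[symmetric] lin
    by (simp add: Q'_G cQ'_def)
qed

text \<open>Checked on the eigenbasis. In a plane the values are \<open>a F - b G\<close> at
  \<open>E (IP j)\<close> and \<open>b F - a G\<close> at \<open>E (IM j)\<close>, with
  \<open>F\<close>, \<open>G\<close> taken at \<open>IP j\<close>; the mixed terms cancel and the
  factor \<open>a^2 - b^2\<close> remains, up to sign.\<close>

lemma Q_diff_Q': "Q x - Q' x = T x"
proof (rule cblinear_eq_on_basis[OF on total, of "\<lambda>x. Q x - Q' x" T])
  show "cblinear (\<lambda>x. Q x - Q' x)"
    by (intro cblinear_diff_fun cblinear_Q cblinear_Q')
  fix i assume i: "i \<in> I"
  show "Q (E i) - Q' (E i) = T (E i)"
  proof (cases i)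
    case (IU k)
    then show ?thesis
      using i by (simp add: Q_E Q'_E T_IU)
  next
    case (IW k)
    then show ?thesis
      using i by (simp add: Q_E Q'_E T_IW)
  next
    case (IP j)
    have "Q (E i) - Q' (E i) = (complex_of_real (a j) * complex_of_real (a j) - complex_of_real (b j) * complex_of_real (b j)) *\<^sub>C E (IP j)"
      by (simp add: IP Q_E Q'_E F_def G_def scaleC_add_right scaleC_scaleC scaleC_diff_left mult.commute)
    then show ?thesis
      by (simp add: of_real_ab IP T_IP)
  next
    case (IM j)
    have "Q (E i) - Q' (E i) = - ((complex_of_real (a j) * complex_of_real (a j) - complex_of_real (b j) * complex_of_real (b j)) *\<^sub>C E (IM j))"
      by (simp add: IM Q_E Q'_E F_def G_def scaleC_add_right scaleC_scaleC scaleC_diff_left mult.commute)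
    then show ?thesis
      by (simp add: of_real_ab IM T_IM)
  qed
qed (rule T)

section \<open>Eigenvector relations and irreducibility\<close>

definition mu :: "ix \<Rightarrow> complex" where
  "mu i = (case i of IU _ \<Rightarrow> 1 | IW _ \<Rightarrow> - 1 | IP j \<Rightarrow> complex_of_real (lam j) | IM j \<Rightarrow> - complex_of_real (lam j))"

lemma cinner_E_T:
  assumes "i \<in> I"
  shows "cinner (E i) (T x) = mu i * cinner (E i) x"
proof -
  have "\<bar>lam j\<bar> \<le> 1" for j
    using lam[of j] by linarith
  then interpret dT: diag I mu E E
    by unfold_locales (use on in \<open>auto simp: mu_def split: ix.splits\<close>)
  have "T x = diag_op I mu E E x"
    by (rule cblinear_eq_on_basis[OF on total T dT.cblinear_diag_op])
      (auto simp: dT.diag_op_basis mu_def T_IU T_IW T_IP T_IM scaleC_minus_left split: ix.splits)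
  then show ?thesis
    using dT.cinner_diag_op[OF assms] by simp
qed

lemma T_G:
  "T (G (IP j)) = complex_of_real (lam j * b j) *\<^sub>C E (IP j) - complex_of_real (lam j * a j) *\<^sub>C E (IM j)"
  by (simp add: G_def cblinear_add[OF T] cblinear_scaleC[OF T] T_IP T_IM scaleC_scaleC scaleC_minus_right mult.commute)

text \<open>\<open>G (IP j)\<close> mixes the eigenvalues \<open>lam j\<close> and
  \<open>- lam j\<close>, which agree after squaring.\<close>

lemma T_T_G: "T (T (G (IP j))) = complex_of_real ((lam j)\<^sup>2) *\<^sub>C G (IP j)"
  by (simp add: T_G cblinear_diff[OF T] cblinear_scaleC[OF T] T_IP T_IM)
    (simp add: G_def scaleC_scaleC scaleC_minus_right scaleC_add_right power2_eq_square mult_ac)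

text \<open>\<open>U\<close> takes \<open>E (IU 0)\<close> to \<open>G (IP 0)\<close>;
  \<open>T\<close> splits each \<open>G (IP j)\<close> into its two eigenvectors, these give
  \<open>F (IP j)\<close>, and \<open>U\<close> moves on to \<open>G (IP (Suc j))\<close>. The
  vectors \<open>F (IM i)\<close> then yield all \<open>E (IU i)\<close>, and these yield all
  \<open>E (IW i)\<close>. As \<open>N\<close> is any invariant subspace, this serves both
  \<open>M\<close> and \<open>corth M\<close>.\<close>

lemma basis_in_invariant:
  assumes N: "csubspace N" and inv: "\<And>x. x \<in> N \<Longrightarrow> U x \<in> N" "\<And>x. x \<in> N \<Longrightarrow> cadj U x \<in> N" "\<And>x. x \<in> N \<Longrightarrow> Q x \<in> N"
    and 0: "E (IU 0) \<in> N" and "i \<in> I"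
  shows "E i \<in> N"
proof -
  have TN: "T x \<in> N" if "x \<in> N" for x
    unfolding Q_diff_Q'[symmetric] Q'_def using that by (intro csubspace_diff N inv)
  have E_G: "E (IP j) \<in> N \<and> E (IM j) \<in> N" if g: "G (IP j) \<in> N" for j
  proof -
    have two: "complex_of_real (2 * lam j * z) = complex_of_real (lam j * z) + complex_of_real (lam j * z)" for z
      by simp
    \<comment> \<open>\<open>T\<close> acts as \<open>lam j\<close> and \<open>- lam j\<close> on
      the two components, so the sum keeps one of them and the difference the other; the remaining
      factors are non-zero.\<close>
    have "complex_of_real (lam j) *\<^sub>C G (IP j) + T (G (IP j)) = complex_of_real (2 * lam j * b j) *\<^sub>C E (IP j)"
      unfolding T_G two scaleC_add_left by (simp add: G_def scaleC_add_right scaleC_scaleC)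
    moreover have "complex_of_real (lam j) *\<^sub>C G (IP j) - T (G (IP j)) = complex_of_real (2 * lam j * a j) *\<^sub>C E (IM j)"
      unfolding T_G two scaleC_add_left by (simp add: G_def scaleC_add_right scaleC_scaleC)
    moreover have "complex_of_real (lam j) *\<^sub>C G (IP j) + T (G (IP j)) \<in> N" "complex_of_real (lam j) *\<^sub>C G (IP j) - T (G (IP j)) \<in> N"
      using g TN N by (auto intro: csubspace_add csubspace_diff csubspace_scaleC)
    moreover have "complex_of_real (2 * lam j * a j) \<noteq> 0" "complex_of_real (2 * lam j * b j) \<noteq> 0"
      using lam(1)[of j] a_nz b_nz by auto
    ultimately show ?thesis
      by (metis csubspace_scaleC_iff[OF N])
  qed
  have FN: "F (IP j) \<in> N" "F (IM j) \<in> N" if "E (IP j) \<in> N" "E (IM j) \<in> N" for j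
    unfolding F_def using that N by (auto intro: csubspace_add csubspace_diff csubspace_scaleC)
  have GN: "G (IP j) \<in> N" for j
  proof (induction j)
    case 0
    then show ?case
      using inv(1)[OF \<open>E (IU 0) \<in> N\<close>] U_F[of "IU 0"] by (simp add: F_def)
  next
    case (Suc j)
    then have "U (F (IP j)) \<in> N"
      using E_G[of j] by (intro inv FN) auto
    then show ?case
      using U_F[of "IP j"] by simp
  qed
  then have EN: "E (IP j) \<in> N" "E (IM j) \<in> N" for j
    using E_G by auto
  have UN: "E (IU i) \<in> N" if "i \<le> m" for i
    using inv(1)[OF FN(2)[OF EN, of i]] U_F[of "IM i"] that by (simp add: G_def)
  have "E (IW i) \<in> N" if "i < m" for i
    using inv(1)[OF UN[of "Suc i"]] U_F[of "IU (Suc i)"] that by (simp add: G_def F_def)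
  with EN UN show ?thesis
    using \<open>i \<in> I\<close> by (cases i) auto
qed

text \<open>Reducing is encoded as invariance of \<open>M\<close> and \<open>corth M\<close>, so
  invariance of one under \<open>cadj U\<close> comes from invariance of the other under
  \<open>U\<close>. For \<open>T\<close> use \<open>T = Q - Q'\<close>.\<close>

lemma invariant_of_reducing:
  assumes "reducing_subspace M U" "reducing_subspace M (\<lambda>x. x - Q x)" "N = M \<or> N = corth M"
  shows "csubspace N" "x \<in> N \<Longrightarrow> U x \<in> N" "x \<in> N \<Longrightarrow> cadj U x \<in> N" "x \<in> N \<Longrightarrow> Q x \<in> N" "x \<in> N \<Longrightarrow> T x \<in> N"
proof -
  have M: "csubspace M" "closed M" and U: "\<And>x. x \<in> M \<Longrightarrow> U x \<in> M" "\<And>x. x \<in> corth M \<Longrightarrow> U x \<in> corth M"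
    using assms(1) by (auto simp: reducing_subspace_def)
  show N: "csubspace N"
    using M assms(3) csubspace_corth by auto
  show UN: "x \<in> N \<Longrightarrow> U x \<in> N" for x
    using U assms(3) by auto
  show QN: "x \<in> N \<Longrightarrow> Q x \<in> N" for x
  proof -
    assume "x \<in> N"
    then have "x - Q x \<in> N"
      using assms(2,3) by (auto simp: reducing_subspace_def)
    then show "Q x \<in> N"
      using csubspace_diff[OF N \<open>x \<in> N\<close>] by fastforce
  qed
  show adj: "x \<in> N \<Longrightarrow> cadj U x \<in> N" for x
    using assms(3)
  proof
    assume x: "x \<in> N" and "N = M"
    obtain p q where p: "p \<in> M" and q: "q \<in> corth M" and e: "cadj U x = p + q"
      using orthogonal_decomposition[OF M] by metis
    \<comment> \<open>Testing \<open>cadj U x\<close> against its own component \<open>q\<close> in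
      \<open>corth M\<close> shows that this component vanishes.\<close>
    have "cinner q (cadj U x) = cinner (U q) x"
      by (rule cinner_U[symmetric])
    also have "\<dots> = 0"
      using U(2)[OF q] x \<open>N = M\<close> cinner_commute_0[of "U q" x] by (simp add: corth_def)
    finally have "cinner q q = 0"
      using p q cinner_commute_0[of p q] by (simp add: e cinner_add_right corth_def)
    then have "q = 0"
      by (simp only: cinner_eq_zero_iff)
    then show "cadj U x \<in> N"
      using p \<open>N = M\<close> by (simp add: e)
  next
    assume x: "x \<in> N" and "N = corth M"
    then show "cadj U x \<in> N"
      using U(1) by (auto simp: corth_def cinner_U[symmetric])
  qed
  show "x \<in> N \<Longrightarrow> T x \<in> N"
    unfolding Q_diff_Q'[symmetric] Q'_def by (intro csubspace_diff N UN QN adj)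
qed

text \<open>The component \<open>p\<close> of \<open>E (IU 0)\<close> in \<open>M\<close> inherits
  the eigenvector relations of that vector, which force \<open>p\<close> to be a multiple of it:
  coefficient zero puts the vector into \<open>corth M\<close>, a non-zero one into
  \<open>M\<close>.\<close>

lemma reducing_dichotomy:
  assumes "reducing_subspace M U" "reducing_subspace M (\<lambda>x. x - Q x)"
  shows "E (IU 0) \<in> M \<or> E (IU 0) \<in> corth M"
proof -
  note invM = invariant_of_reducing[OF assms disjI1[OF refl]]
  note invN = invariant_of_reducing[OF assms disjI2[OF refl]]
  have "closed M"
    using assms(1) by (simp add: reducing_subspace_def)
  obtain p q where p: "p \<in> M" and q: "q \<in> corth M" and e: "E (IU 0) = p + q"
    using orthogonal_decomposition[OF invM(1) \<open>closed M\<close>] by metis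
  have "T p + T q = p + q"
    using T_IU[of 0] by (simp add: e cblinear_add[OF T])
  \<comment> \<open>The left side lies in \<open>M\<close> and the right side in
    \<open>corth M\<close>, so both vanish.\<close>
  then have "T p - p = q - T q"
    by (simp add: algebra_simps)
  then have Tp: "T p = p"
    using corth_Int_0[of "T p - p" M] csubspace_diff[OF invM(1) invM(5)[OF p] p]
      csubspace_diff[OF invN(1) q invN(5)[OF q]] by simp
  \<comment> \<open>\<open>U p\<close> is the \<open>M\<close>-component of an eigenvector of \<open>T\<^sup>2\<close> for \<open>\<lambda>\<^sub>0\<^sup>2 < 1\<close>, hence orthogonal to the
    eigenvectors \<open>E (IW k)\<close>, the images under \<open>U\<close> of all \<open>E (IU i)\<close> with \<open>i > 0\<close>.\<close>
  have "U p + U q = G (IP 0)"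
    using U_F[of "IU 0"] by (simp add: e cblinear_add[OF cblinear_U, symmetric] F_def)
  then have "T (T (U p)) + T (T (U q)) = complex_of_real ((lam 0)\<^sup>2) *\<^sub>C (U p + U q)"
    using T_T_G[of 0] by (simp add: cblinear_add[OF T, symmetric])
  then have *: "T (T (U p)) - complex_of_real ((lam 0)\<^sup>2) *\<^sub>C U p = complex_of_real ((lam 0)\<^sup>2) *\<^sub>C U q - T (T (U q))"
    by (simp add: algebra_simps scaleC_add_right)
  have "T (T (U p)) - complex_of_real ((lam 0)\<^sup>2) *\<^sub>C U p \<in> M"
    using p by (intro csubspace_diff csubspace_scaleC invM)
  moreover have "complex_of_real ((lam 0)\<^sup>2) *\<^sub>C U q - T (T (U q)) \<in> corth M"
    using q by (intro csubspace_diff csubspace_scaleC invN)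
  ultimately have TTUp: "T (T (U p)) = complex_of_real ((lam 0)\<^sup>2) *\<^sub>C U p"
    using corth_Int_0[of "T (T (U p)) - complex_of_real ((lam 0)\<^sup>2) *\<^sub>C U p" M] * by simp
  have l1: "complex_of_real (lam 0) * complex_of_real (lam 0) \<noteq> 1"
  proof -
    have "lam 0 * lam 0 < 1"
      using lam[of 0] by (metis less_eq_real_def mult_strict_mono mult_1 zero_less_one)
    then show ?thesis
      by (metis less_irrefl of_real_eq_1_iff of_real_mult)
  qed
  \<comment> \<open>Since \<open>T p = p\<close>, only eigenvalue \<open>1\<close> can contribute.
    For \<open>IU (Suc k)\<close> the coefficient is read off after applying \<open>U\<close>, which
    takes \<open>F (IU (Suc k))\<close> to \<open>E (IW k)\<close>.\<close>
  have orth: "cinner (E i) p = 0" if i: "i \<in> I" "i \<noteq> IU 0" for i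
  proof (cases "mu i = 1")
    case False
    then show ?thesis
      using cinner_E_T[OF i(1), of p] by (simp add: Tp)
  next
    case True
    have "complex_of_real (lam j) \<noteq> 1" "- complex_of_real (lam j) \<noteq> 1" for j
      using lam[of j] by (auto simp: complex_eq_iff)
    with True obtain k where k: "i = IU (Suc k)"
      using i(2) by (cases i) (auto simp: mu_def gr0_conv_Suc)
    then have k': "Suc k \<le> m"
      using i by simp
    have "cinner (E (IW k)) (U p) = complex_of_real ((lam 0)\<^sup>2) * cinner (E (IW k)) (U p)"
      using cinner_E_T[of "IW k" "U p"] cinner_E_T[of "IW k" "T (U p)"] k' by (simp add: mu_def TTUp cinner_simps)
    then have "cinner (E (IW k)) (U p) = 0"
      using l1 by (simp add: power2_eq_square)
    moreover have "cinner (G' i) (U p) = cinner (F i) p"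
      unfolding U_def using dU.cinner_diag_op[OF i(1)] by simp
    ultimately show ?thesis
      using k by (simp add: F_def G_def G'_def)
  qed
  have "p = cinner (E (IU 0)) p *\<^sub>C E (IU 0)"
  proof (rule total_on_eqI[OF total])
    fix i assume "i \<in> I"
    then have "cinner (E i) (E (IU 0)) = (if i = IU 0 then 1 else 0)"
      using on by (auto simp: orthonormal_on_def)
    then show "cinner (E i) p = cinner (E i) (cinner (E (IU 0)) p *\<^sub>C E (IU 0))"
      using orth[OF \<open>i \<in> I\<close>] by (auto simp: cinner_simps)
  qed
  then show ?thesis
    using p q e csubspace_scaleC_iff[OF invM(1)] by (metis add_0 scaleC_0)
qed

theorem exists_irreducible:
  "\<exists>U P. unitary_op U \<and> cprojection P \<and> no_common_reducing U P \<and>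
    (\<forall>x. (x - P x) - U (cadj U x - P (cadj U x)) = T x)"
proof (intro exI conjI allI)
  show "unitary_op U"
    by (rule unitary_U)
  \<comment> \<open>The complement of this projection is \<open>Q\<close>, so the defect operator is
    \<open>Q - Q'\<close>.\<close>
  show "cprojection (\<lambda>x. x - Q x)"
    by (rule cprojection_complement[OF cprojection_Q])
  show "x - (x - Q x) - U (cadj U x - (cadj U x - Q (cadj U x))) = T x" for x
    using Q_diff_Q'[of x] by (simp add: Q'_def)
  show "no_common_reducing U (\<lambda>x. x - Q x)"
    unfolding no_common_reducing_def
  proof (intro allI impI, elim conjE)
    fix M assume red: "reducing_subspace M U" "reducing_subspace M (\<lambda>x. x - Q x)"
    have M: "csubspace M" "closed M"
      using red by (auto simp: reducing_subspace_def)
    from reducing_dichotomy[OF red] show "M = {0} \<or> M = UNIV"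
    proof
      assume "E (IU 0) \<in> M"
      then have EM: "E i \<in> M" if "i \<in> I" for i
        using basis_in_invariant invariant_of_reducing[OF red disjI1[OF refl]] that by blast
      have "x \<in> M" for x
      proof -
        obtain p q where p: "p \<in> M" and q: "q \<in> corth M" and e: "x = p + q"
          using orthogonal_decomposition[OF M] by metis
        have "q = 0"
          using total EM q by (auto simp: total_on_def corth_def)
        with p e show ?thesis
          by simp
      qed
      then show ?thesis
        by blast
    next
      assume "E (IU 0) \<in> corth M"
      then have EM: "E i \<in> corth M" if "i \<in> I" for i
        using basis_in_invariant invariant_of_reducing[OF red disjI2[OF refl]] that by blast
      have "x = 0" if "x \<in> M" for x
        using total EM that cinner_commute_0 unfolding total_on_def corth_def by blast
      then show ?thesis
        using M by (auto simp: csubspace_def)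
    qed
  qed
qed

end

subsection \<open>Compact self-adjoint operators\<close>

lemma norm_diff_square:
  "(norm (x - y))\<^sup>2 = (norm x)\<^sup>2 + (norm y)\<^sup>2 - 2 * Re (cinner x (y::'a::complex_inner))"
proof -
  have "(norm z)\<^sup>2 = Re (cinner z z)" for z :: 'a
    by (simp add: cinner_self)
  moreover have "Re (cinner y x) = Re (cinner x y)"
    by (subst cinner_commute) simp
  ultimately show ?thesis
    by (simp add: cinner_simps)
qed

lemma norm_eq_1_iff: "norm (x::'a::complex_inner) = 1 \<longleftrightarrow> cinner x x = 1"
  unfolding cinner_self of_real_eq_1_iff using abs_square_eq_1[of "norm x"] by simp

lemma compact_op_subsequence:
  assumes "compact_op T" "\<And>n::nat. norm (x n) \<le> 1"
  obtains l r where "strict_mono (r::nat \<Rightarrow> nat)" "(\<lambda>n. T (x (r n))) \<longlonglongrightarrow> l"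
proof -
  have "compact (closure (T ` cball 0 1))"
    using assms(1) by (simp add: compact_op_def)
  then have "seq_compact (closure (T ` cball 0 1))"
    by (rule compact_imp_seq_compact)
  moreover have "T (x n) \<in> closure (T ` cball 0 1)" for n
    using assms(2)[of n] closure_subset by (force simp: dist_norm)
  ultimately obtain l r where "strict_mono r" "((\<lambda>n. T (x n)) \<circ> r) \<longlonglongrightarrow> l"
    using seq_compactE by metis
  with that show thesis
    by (simp add: o_def)
qed

lemma csubspace_eigenspace: "cblinear T \<Longrightarrow> csubspace (eigenspace c T)"
  by (auto simp: csubspace_def eigenspace_def cblinear_0 cblinear_add cblinear_scaleC
      scaleC_add_right scaleC_scaleC mult.commute)

lemma csubspace_normalize:
  assumes "csubspace N" "N \<noteq> {0}"
  obtains x where "x \<in> N" "norm (x::'a::complex_inner) = 1"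
proof -
  obtain x where x: "x \<in> N" "x \<noteq> 0"
    using assms by (auto simp: csubspace_def)
  then have "complex_of_real (1 / norm x) *\<^sub>C x \<in> N" "norm (complex_of_real (1 / norm x) *\<^sub>C x) = 1"
    using csubspace_scaleC[OF assms(1)] by (auto simp: norm_scaleC norm_divide)
  with that show thesis
    by blast
qed

lemma exists_eigenvector_in_invariant:
  fixes T :: "'a::complex_inner \<Rightarrow> 'a"
  assumes compact: "compact_op T" and adj: "\<And>x y. cinner (T x) y = cinner x (T y)"
    and inj: "\<And>x. T x = 0 \<Longrightarrow> x = 0"
    and N: "csubspace N" "closed N" "N \<noteq> {0}" and TN: "\<And>x. x \<in> N \<Longrightarrow> T x \<in> N"
  shows "\<exists>x\<in>N. \<exists>r::real. x \<noteq> 0 \<and> T x = complex_of_real r *\<^sub>C x"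
proof -
  \<comment> \<open>With \<open>s\<close> the norm of \<open>T\<close> on \<open>N\<close>, a norming sequence converges along a subsequence to an eigenvector
    \<open>y\<close> of \<open>T\<^sup>2\<close> for \<open>s\<^sup>2\<close>; then \<open>(T - s)(T + s) y = 0\<close>.\<close>
  have T: "cblinear T"
    using compact by (simp add: compact_op_def)
  have bl: "bounded_linear T"
    by (rule cblinear_bounded_linear[OF T])
  define S where "S = {norm (T x) | x. x \<in> N \<and> norm x = 1}"
  define s where "s = Sup S"
  obtain x0 where x0: "x0 \<in> N" "norm x0 = 1"
    using csubspace_normalize[OF N(1,3)] by blast
  obtain K where K: "\<And>x. norm (T x) \<le> norm x * K"
    using T unfolding cblinear_def by blast
  have bdd: "bdd_above S"
    unfolding S_def bdd_above_def using K by (intro exI[of _ K]) (auto, metis mult_1)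
  have le_s: "norm (T x) \<le> s" if "x \<in> N" "norm x = 1" for x
    unfolding s_def by (rule cSup_upper[OF _ bdd]) (use that in \<open>auto simp: S_def\<close>)
  have "T x0 \<noteq> 0"
    using inj[of x0] x0 by auto
  then have "s > 0"
    using le_s[OF x0] by (smt (verit) zero_less_norm_iff)
  have le: "norm (T x) \<le> s * norm x" if "x \<in> N" for x
  proof (cases "x = 0")
    case False
    define y where "y = complex_of_real (1 / norm x) *\<^sub>C x"
    have "y \<in> N" "norm y = 1"
      using that False N by (auto simp: y_def norm_scaleC norm_divide csubspace_scaleC)
    then have "norm (T y) \<le> s"
      by (rule le_s)
    moreover have "norm (T y) = norm (T x) / norm x"
      by (simp add: y_def cblinear_scaleC[OF T] norm_scaleC norm_divide)
    ultimately show ?thesis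
      using False by (simp add: divide_le_eq)
  qed (simp add: cblinear_0[OF T])
  have "\<exists>x. x \<in> N \<and> norm x = 1 \<and> s - 1 / Suc n < norm (T x)" for n
  proof -
    have "s - 1 / Suc n < Sup S"
      by (simp add: s_def)
    then obtain t where "t \<in> S" "s - 1 / Suc n < t"
      using less_cSup_iff[OF _ bdd] x0 unfolding S_def by blast
    then show ?thesis
      by (auto simp: S_def)
  qed
  then obtain x where x: "\<And>n. x n \<in> N" "\<And>n. norm (x n) = 1" "\<And>n. s - 1 / Suc n < norm (T (x n))"
    by metis
  obtain l r where r: "strict_mono r" and l: "(\<lambda>n. T (x (r n))) \<longlonglongrightarrow> l"
    by (rule compact_op_subsequence[OF compact, of x]) (simp_all add: x(2))
  define z where "z n = x (r n)" for n
  have "(\<lambda>n. norm (T (x n))) \<longlonglongrightarrow> s"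
  proof (rule tendsto_sandwich[of "\<lambda>n. s - 1 / Suc n" _ _ "\<lambda>_. s"])
    show "(\<lambda>n. s - 1 / Suc n) \<longlonglongrightarrow> s"
      using tendsto_diff[OF tendsto_const[of s] LIMSEQ_inverse_real_of_nat] by (simp add: inverse_eq_divide)
  qed (use x le_s in \<open>auto intro!: always_eventually less_imp_le\<close>)
  then have nTz: "(\<lambda>n. norm (T (z n))) \<longlonglongrightarrow> s"
    using LIMSEQ_subseq_LIMSEQ[OF _ r] by (auto simp: o_def z_def)
  \<comment> \<open>Expanding the square gives the cross term
    \<open>- 2 * s^2 * norm (T (z n))^2\<close>, and the bound \<open>s\<close> on \<open>N\<close>
    controls \<open>T (T (z n))\<close>.\<close>
  have sq: "(norm (T (T (z n)) - complex_of_real (s\<^sup>2) *\<^sub>C z n))\<^sup>2 \<le> s\<^sup>2 * (s\<^sup>2 - (norm (T (z n)))\<^sup>2)" for n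
  proof -
    have h1: "Re (cinner (T (T (z n))) (complex_of_real (s\<^sup>2) *\<^sub>C z n)) = s\<^sup>2 * (norm (T (z n)))\<^sup>2"
      unfolding adj[of "T (z n)"] cblinear_scaleC[OF T] cinner_scaleC_right cinner_self
      by (simp add: power2_eq_square)
    have h2: "norm (complex_of_real (s\<^sup>2) *\<^sub>C z n) = s\<^sup>2"
      by (simp add: norm_scaleC z_def x norm_power)
    have h3: "(norm (T (T (z n))))\<^sup>2 \<le> s\<^sup>2 * (norm (T (z n)))\<^sup>2"
      using le[OF TN[OF x(1)]] unfolding z_def power_mult_distrib[symmetric] by (intro power_mono) auto
    have h4: "s\<^sup>2 * (s\<^sup>2 - (norm (T (z n)))\<^sup>2) = (s\<^sup>2)\<^sup>2 - s\<^sup>2 * (norm (T (z n)))\<^sup>2"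
      by (simp add: right_diff_distrib power2_eq_square[of "s\<^sup>2"])
    show ?thesis
      unfolding norm_diff_square h1 h2 h4 using h3 by linarith
  qed
  have lim: "(\<lambda>n. s\<^sup>2 * (s\<^sup>2 - (norm (T (z n)))\<^sup>2)) \<longlonglongrightarrow> s\<^sup>2 * (s\<^sup>2 - s\<^sup>2)"
    by (intro tendsto_intros nTz)
  have "(\<lambda>n. (norm (T (T (z n)) - complex_of_real (s\<^sup>2) *\<^sub>C z n))\<^sup>2) \<longlonglongrightarrow> 0"
  proof (rule tendsto_sandwich[OF _ _ tendsto_const])
    show "(\<lambda>n. s\<^sup>2 * (s\<^sup>2 - (norm (T (z n)))\<^sup>2)) \<longlonglongrightarrow> 0"
      using lim by (simp only: diff_self mult_zero_right)
    show "\<forall>\<^sub>F n in sequentially. (norm (T (T (z n)) - complex_of_real (s\<^sup>2) *\<^sub>C z n))\<^sup>2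
        \<le> s\<^sup>2 * (s\<^sup>2 - (norm (T (z n)))\<^sup>2)"
      by (rule always_eventually) (intro allI sq)
  qed simp
  then have d0: "(\<lambda>n. T (T (z n)) - complex_of_real (s\<^sup>2) *\<^sub>C z n) \<longlonglongrightarrow> 0"
    using tendsto_real_sqrt by (fastforce simp: tendsto_norm_zero_iff)
  have TTz: "(\<lambda>n. T (T (z n))) \<longlonglongrightarrow> T l"
    using bounded_linear.tendsto[OF bl l] by (simp add: z_def)
  \<comment> \<open>Compactness gives convergence of \<open>T (z n)\<close> only; the vanishing
    difference transfers it to the vectors \<open>z n\<close> themselves, scaled by
    \<open>s^2\<close>.\<close>
  then have sz: "(\<lambda>n. complex_of_real (s\<^sup>2) *\<^sub>C z n) \<longlonglongrightarrow> T l"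
    using tendsto_diff[OF TTz d0] by simp
  define y where "y = T l"
  have "y \<in> N"
    unfolding y_def by (rule closed_sequentially[OF N(2) _ sz]) (simp add: csubspace_scaleC[OF N(1)] z_def x)
  have "(\<lambda>n. norm (complex_of_real (s\<^sup>2) *\<^sub>C z n)) \<longlonglongrightarrow> norm y"
    unfolding y_def by (rule tendsto_norm[OF sz])
  moreover have "norm (complex_of_real (s\<^sup>2) *\<^sub>C z n) = s\<^sup>2" for n
    by (simp add: norm_scaleC z_def x norm_power)
  ultimately have "norm y = s\<^sup>2"
    using LIMSEQ_unique[OF tendsto_const] by fastforce
  then have "y \<noteq> 0"
    using \<open>s > 0\<close> by auto
  have "(\<lambda>n. T (T (complex_of_real (s\<^sup>2) *\<^sub>C z n))) \<longlonglongrightarrow> T (T y)"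
    unfolding y_def by (intro bounded_linear.tendsto[OF bl] sz)
  moreover have "(\<lambda>n. T (T (complex_of_real (s\<^sup>2) *\<^sub>C z n))) \<longlonglongrightarrow> complex_of_real (s\<^sup>2) *\<^sub>C y"
    unfolding cblinear_scaleC[OF T] y_def by (intro bounded_linear.tendsto[OF bounded_linear_scaleC] TTz)
  ultimately have TTy: "T (T y) = complex_of_real (s\<^sup>2) *\<^sub>C y"
    by (rule LIMSEQ_unique)
  define w where "w = T y + complex_of_real s *\<^sub>C y"
  have "w \<in> N"
    unfolding w_def by (intro csubspace_add csubspace_scaleC N TN \<open>y \<in> N\<close>)
  have Tw: "T w = complex_of_real s *\<^sub>C w"
    by (simp add: w_def cblinear_add[OF T] cblinear_scaleC[OF T] TTy scaleC_add_right scaleC_scaleC power2_eq_square add.commute)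
  show ?thesis
  proof (cases "w = 0")
    case True
    then have "T y = complex_of_real (- s) *\<^sub>C y"
      by (simp add: w_def scaleC_minus_left eq_neg_iff_add_eq_0)
    with \<open>y \<in> N\<close> \<open>y \<noteq> 0\<close> show ?thesis
      by blast
  next
    case False
    with \<open>w \<in> N\<close> Tw show ?thesis
      by blast
  qed
qed

text \<open>The orthogonal complement of all eigenvectors is closed and invariant; if it were
  non-zero it would contain an eigenvector, orthogonal to itself.\<close>

lemma eigenvectors_total:
  fixes T :: "'a::complex_inner \<Rightarrow> 'a"
  assumes compact: "compact_op T" and adj: "\<And>x y. cinner (T x) y = cinner x (T y)"
    and inj: "\<And>x. T x = 0 \<Longrightarrow> x = 0"
    and orth: "\<And>r e. e \<in> eigenspace (complex_of_real r) T \<Longrightarrow> cinner e x = 0"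
  shows "x = 0"
proof -
  define D where "D = (\<Union>r::real. eigenspace (complex_of_real r) T)"
  have "T y \<in> corth D" if "y \<in> corth D" for y
    unfolding corth_def
  proof (intro CollectI ballI)
    fix e assume "e \<in> D"
    then obtain r where "T e = complex_of_real r *\<^sub>C e"
      by (auto simp: D_def eigenspace_def)
    then show "cinner e (T y) = 0"
      using that \<open>e \<in> D\<close> by (simp add: adj[symmetric] cinner_simps corth_def)
  qed
  then have "corth D = {0}"
    using exists_eigenvector_in_invariant[OF compact adj inj csubspace_corth closed_corth, of D]
      corth_Int_0[of _ D] by (auto simp: D_def eigenspace_def)
  moreover have "x \<in> corth D"
    using orth by (auto simp: corth_def D_def)
  ultimately show ?thesis
    by blast
qed

text \<open>Distinct members of \<open>B\<close> have images at distance at least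
  \<open>\<epsilon>\<close>, by orthogonality, so an infinite sequence of them would have no Cauchy
  subsequence of images.\<close>

lemma finite_orthonormal_eigenvectors:
  fixes T :: "'a::complex_inner \<Rightarrow> 'a"
  assumes compact: "compact_op T" and on: "orthonormal_on B id" and "\<epsilon> > 0"
    and eig: "\<And>e. e \<in> B \<Longrightarrow> \<exists>c. \<epsilon> \<le> cmod c \<and> T e = c *\<^sub>C e"
  shows "finite B"
proof (rule ccontr)
  assume "infinite B"
  then obtain e :: "nat \<Rightarrow> 'a" where e: "inj e" "range e \<subseteq> B"
    using infinite_countable_subset by blast
  have "\<exists>c. \<epsilon> \<le> cmod c \<and> T (e n) = c *\<^sub>C e n" for n
    by (rule eig) (use e in auto)
  then obtain c where c: "\<And>n. \<epsilon> \<le> cmod (c n)" "\<And>n. T (e n) = c n *\<^sub>C e n"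
    by metis
  have ee: "cinner (e i) (e j) = (if i = j then 1 else 0)" for i j
    using on e by (auto simp: orthonormal_on_def inj_eq image_subset_iff)
  then have n1: "norm (e n) = 1" for n
    by (simp add: norm_eq_1_iff)
  obtain l r where r: "strict_mono r" and l: "(\<lambda>n. T (e (r n))) \<longlonglongrightarrow> l"
    by (rule compact_op_subsequence[OF compact, of e]) (simp_all add: n1)
  have "Cauchy (\<lambda>n. T (e (r n)))"
    using l by (rule LIMSEQ_imp_Cauchy)
  then obtain M where M: "\<And>i j. i \<ge> M \<Longrightarrow> j \<ge> M \<Longrightarrow> dist (T (e (r i))) (T (e (r j))) < \<epsilon>"
    using \<open>\<epsilon> > 0\<close> by (metis Cauchy_def)
  define i where "i = r M"
  define j where "j = r (Suc M)"
  have "i \<noteq> j"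
    using strict_monoD[OF r, of M "Suc M"] by (simp add: i_def j_def)
  have "norm (T (e i) - T (e j)) < \<epsilon>"
    using M[of M "Suc M"] by (simp add: i_def j_def dist_norm)
  then have "(norm (T (e i) - T (e j)))\<^sup>2 < \<epsilon>\<^sup>2"
    by (intro power_strict_mono) auto
  moreover have "(norm (T (e i) - T (e j)))\<^sup>2 = (cmod (c i))\<^sup>2 + (cmod (c j))\<^sup>2"
    using \<open>i \<noteq> j\<close> by (simp add: norm_diff_square c(2) cinner_simps ee norm_scaleC n1)
  moreover have "\<epsilon>\<^sup>2 \<le> (cmod (c i))\<^sup>2"
    using c(1) \<open>\<epsilon> > 0\<close> by (intro power_mono) auto
  moreover have "0 \<le> (cmod (c j))\<^sup>2"
    by simp
  ultimately show False
    by linarith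
qed

subsection \<open>Dimension\<close>

lemma cspan_superset: "S \<subseteq> cspan S"
  unfolding cspan_def by (rule hull_subset)

lemma csubspace_cspan: "csubspace (cspan S)"
  unfolding cspan_def by (rule hull_in) (auto simp: csubspace_def)

lemma csubspace_sum: "csubspace M \<Longrightarrow> (\<And>i. i \<in> F \<Longrightarrow> f i \<in> M) \<Longrightarrow> sum f F \<in> M"
  by (induction F rule: infinite_finite_induct) (auto simp: csubspace_def)

lemma cspan_finite_orthonormal:
  fixes M :: "'a::complex_inner set"
  assumes "csubspace M" "finite B" "orthonormal_on B id" "B \<subseteq> M"
    and total: "\<And>x. x \<in> M \<Longrightarrow> (\<And>e. e \<in> B \<Longrightarrow> cinner e x = 0) \<Longrightarrow> x = 0"
  shows "cspan B = M"
proof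
  show "cspan B \<subseteq> M"
    unfolding cspan_def using assms by (intro hull_minimal)
  show "M \<subseteq> cspan B"
  proof
    fix x assume "x \<in> M"
    let ?s = "\<Sum>e\<in>B. cinner e x *\<^sub>C e"
    have "?s \<in> M"
      using assms by (auto intro!: csubspace_sum csubspace_scaleC)
    then have "x - ?s \<in> M"
      using csubspace_diff assms(1) \<open>x \<in> M\<close> by blast
    moreover have "cinner e (x - ?s) = 0" if "e \<in> B" for e
      using orthonormal_residual[OF assms(3,2) subset_refl that, of x] by simp
    ultimately have "x - ?s = 0"
      using total by blast
    moreover have "?s \<in> cspan B"
      using csubspace_cspan cspan_superset by (intro csubspace_sum csubspace_scaleC) auto
    ultimately show "x \<in> cspan B"
      by simp
  qed
qed

text \<open>Orthonormal sets are linearly independent, and by the exchange lemma no spanning set is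
  smaller than an independent one.\<close>

lemma cdim_orthonormal:
  fixes B :: "'a::complex_inner set"
  assumes "finite B" "orthonormal_on B id"
  shows "cdim (cspan B) = enat (card B)"
proof -
  interpret cvec: vector_space "scaleC :: complex \<Rightarrow> 'a \<Rightarrow> 'a"
    by unfold_locales (simp_all add: scaleC_add_right scaleC_add_left scaleC_scaleC)
  have span: "cvec.span S = cspan S" for S
    unfolding cvec.span_def cspan_def
    by (rule arg_cong[of _ _ "\<lambda>P. P hull S"]) (auto simp: fun_eq_iff cvec.subspace_def csubspace_def)
  have "cvec.independent B"
    unfolding cvec.independent_explicit_module
  proof (intro allI impI)
    fix t u v assume t: "finite t" "t \<subseteq> B" "(\<Sum>v\<in>t. u v *\<^sub>C v) = 0" "v \<in> t"
    have "(\<Sum>v\<in>t. (cmod (u v))\<^sup>2) = 0"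
      using norm_sum_orthonormal[OF assms(2) t(1,2), of u] t(3) by simp
    then show "u v = 0"
      using t(1,4) by (subst (asm) sum_nonneg_eq_0_iff) auto
  qed
  then have ge: "card B \<le> card C" if "finite C" "cspan C = cspan B" for C
    using cvec.independent_span_bound[OF that(1), of B] that(2) cspan_superset[of B] by (simp add: span)
  have "(LEAST n. \<exists>C. finite C \<and> card C = n \<and> cspan C = cspan B) = card B"
    by (rule Least_equality) (use assms ge in auto)
  then show ?thesis
    unfolding cdim_def using assms by auto
qed

subsection \<open>Eigenbases of defect operators\<close>

locale compact_selfadjoint =
  fixes T :: "'a::complex_inner \<Rightarrow> 'a"
  assumes compact: "compact_op T" and adj: "\<And>x y. cinner (T x) y = cinner x (T y)"
    and inj: "\<And>x. T x = 0 \<Longrightarrow> x = 0"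
begin

lemma T: "cblinear T"
  using compact by (simp add: compact_op_def)

abbreviation eig :: "real \<Rightarrow> 'a set" where "eig r \<equiv> eigenspace (complex_of_real r) T"

lemma eig_orth:
  assumes "x \<in> eig r" "y \<in> eig s" "r \<noteq> s"
  shows "cinner x y = 0"
proof -
  have "complex_of_real r * cinner x y = complex_of_real s * cinner x y"
    using adj[of x y] assms by (simp add: eigenspace_def cinner_simps)
  with assms(3) show ?thesis
    by simp
qed

text \<open>A fixed choice for every real \<open>r\<close>; it is empty when \<open>r\<close> is not
  an eigenvalue.\<close>

definition basis :: "real \<Rightarrow> 'a set" where
  "basis r = (SOME B. B \<subseteq> eig r \<and> orthonormal_on B id \<and>
     (\<forall>x\<in>eig r. (\<forall>e\<in>B. cinner e x = 0) \<longrightarrow> x = 0))"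

lemma basis:
  shows basis_subset: "basis r \<subseteq> eig r" and basis_on: "orthonormal_on (basis r) id"
    and basis_total: "x \<in> eig r \<Longrightarrow> (\<And>e. e \<in> basis r \<Longrightarrow> cinner e x = 0) \<Longrightarrow> x = 0"
proof -
  obtain B where B: "B \<subseteq> eig r" "orthonormal_on B id"
    and max: "\<And>C. B \<subseteq> C \<Longrightarrow> C \<subseteq> eig r \<Longrightarrow> orthonormal_on C id \<Longrightarrow> C = B"
    using maximal_orthonormal_set by blast
  have "\<forall>x\<in>eig r. (\<forall>e\<in>B. cinner e x = 0) \<longrightarrow> x = 0"
    using maximal_orthonormal_orth[OF csubspace_eigenspace[OF T] B(2,1) max] by blast
  with B have "\<exists>B. B \<subseteq> eig r \<and> orthonormal_on B id \<and> (\<forall>x\<in>eig r. (\<forall>e\<in>B. cinner e x = 0) \<longrightarrow> x = 0)"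
    by blast
  from someI_ex[OF this]
  show "basis r \<subseteq> eig r" "orthonormal_on (basis r) id"
    "x \<in> eig r \<Longrightarrow> (\<And>e. e \<in> basis r \<Longrightarrow> cinner e x = 0) \<Longrightarrow> x = 0"
    unfolding basis_def[symmetric] by blast+
qed

lemma basis_eig: "e \<in> basis r \<Longrightarrow> T e = complex_of_real r *\<^sub>C e"
  using basis_subset[of r] by (auto simp: eigenspace_def)

lemma basis_unit: "e \<in> basis r \<Longrightarrow> cinner e e = 1"
  using basis_on[of r] by (simp add: orthonormal_on_def)

lemma basis_nz: "e \<in> basis r \<Longrightarrow> r \<noteq> 0"
  using inj[of e] basis_eig[of e r] basis_unit[of e r] by auto

lemma basis_eigenvalue_unique:
  assumes "e \<in> basis r" "e \<in> basis s"
  shows "r = s"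
  using eig_orth[of e r e s] basis_subset[of r] basis_subset[of s] basis_unit[OF assms(1)] assms by auto

lemma basis_cinner:
  assumes "e \<in> basis r" "f \<in> basis s"
  shows "cinner e f = (if e = f then 1 else 0)"
proof (cases "r = s")
  case True
  then show ?thesis
    using basis_on[of s] assms by (simp add: orthonormal_on_def)
next
  case False
  then show ?thesis
    using eig_orth[of e r f s] basis_subset[of r] basis_subset[of s] assms basis_eigenvalue_unique by auto
qed

text \<open>Injectivity settles \<open>r = 0\<close>, compactness every other
  \<open>r\<close>.\<close>

lemma finite_basis: "finite (basis r)"
proof (cases "r = 0")
  case True
  then have "basis r = {}"
    using basis_nz by blast
  then show ?thesis
    by simp
next
  case False
  then show ?thesis
    by (intro finite_orthonormal_eigenvectors[OF compact basis_on, of "\<bar>r\<bar>"])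
      (auto simp: basis_eig intro: exI[of _ "complex_of_real r"])
qed

lemma cdim_eig: "cdim (eig r) = enat (card (basis r))"
  using cspan_finite_orthonormal[OF csubspace_eigenspace[OF T] finite_basis basis_on basis_subset basis_total]
    cdim_orthonormal[OF finite_basis basis_on, of r] by simp

definition bases :: "'a set" where "bases = (\<Union>r. basis r)"

lemma bases_on: "orthonormal_on bases id"
  unfolding bases_def orthonormal_on_def using basis_cinner by auto

lemma bases_total:
  assumes "\<And>e. e \<in> bases \<Longrightarrow> cinner e x = 0"
  shows "x = 0"
proof (rule eigenvectors_total[OF compact adj inj])
  fix r e assume e: "e \<in> eig r"
  have "cspan (basis r) = eig r"
    by (rule cspan_finite_orthonormal[OF csubspace_eigenspace[OF T] finite_basis basis_on basis_subset basis_total])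
  moreover have "cspan (basis r) \<subseteq> {y. cinner y x = 0}"
    unfolding cspan_def
    by (rule hull_minimal) (use assms in \<open>auto simp: bases_def csubspace_def cinner_simps\<close>)
  ultimately show "cinner e x = 0"
    using e by blast
qed

lemma bases_infinite:
  assumes "cdim (UNIV :: 'a set) = \<infinity>"
  shows "infinite bases"
proof
  assume "finite bases"
  then have "cspan bases = UNIV"
    using bases_on bases_total by (intro cspan_finite_orthonormal) (auto simp: csubspace_def)
  with cdim_orthonormal[OF \<open>finite bases\<close> bases_on] assms show False
    by simp
qed

end

text \<open>All eigenvalues lie in \<open>[- 1, 1]\<close> without \<open>0\<close>. Equal
  multiplicities match the eigenvectors for \<open>r\<close> with those for \<open>- r\<close> when
  \<open>0 < r < 1\<close>, and the positive ones of these form a countably infinite set, enumerated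
  by \<open>ep\<close>.\<close>

lemma exists_paired_eigenbasis:
  fixes T :: "'a::chilbert_space \<Rightarrow> 'a"
  assumes inf: "cdim (UNIV :: 'a set) = \<infinity>" and df: "defect_form T"
    and dim1: "cdim (eigenspace 1 T) = cdim (eigenspace (-1) T) + 1"
  shows "\<exists>E lam m. paired_eigenbasis T E lam m"
proof -
  have lin: "cblinear T"
    using df by (simp add: defect_form_def compact_op_def)
  interpret compact_selfadjoint T
  proof
    show "compact_op T"
      using df by (simp add: defect_form_def)
    show "cinner (T x) y = cinner x (T y)" for x y
      using adjoint_exists[OF lin] df by (metis defect_form_def)
    show "x = 0" if "T x = 0" for x
    proof -
      have "inj T"
        using df by (simp add: defect_form_def)
      then show ?thesis
        using that cblinear_0[OF lin] by (metis injD)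
    qed
  qed
  have basis_le: "\<bar>r\<bar> \<le> 1" if "e \<in> basis r" for e r
  proof -
    have "norm (T e) \<le> norm e"
      using df by (simp add: defect_form_def)
    moreover have "norm e = 1"
      using basis_unit[OF that] by (simp add: norm_eq_1_iff)
    ultimately show ?thesis
      using basis_eig[OF that] by (simp add: norm_scaleC)
  qed
  \<comment> \<open>Finite by compactness, so the hypothesis on \<open>cdim\<close> becomes an
    equation between natural numbers.\<close>
  define m where "m = card (basis (-1))"
  have card1: "card (basis 1) = Suc m"
    using dim1 cdim_eig[of 1] cdim_eig[of "-1"] by (simp add: m_def one_enat_def)
  obtain w where w: "bij_betw w {..<m} (basis (-1))"
    using ex_bij_betw_nat_finite[OF finite_basis, of "-1"] by (auto simp: m_def atLeast0LessThan)
  obtain u where u: "bij_betw u {..m} (basis 1)"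
    using ex_bij_betw_nat_finite[OF finite_basis, of 1] by (auto simp: card1 atLeast0LessThan lessThan_Suc_atMost)
  have "\<exists>h. bij_betw h (basis r) (basis (- r))" if "0 < r" "r < 1" for r
  proof -
    have "cdim (eig r) = cdim (eig (- r))"
      using df that by (simp add: defect_form_def)
    then have "card (basis r) = card (basis (- r))"
      by (simp only: cdim_eig enat.inject)
    then show ?thesis
      using finite_basis by (simp add: bij_betw_iff_card)
  qed
  then obtain h where h: "\<And>r. 0 < r \<Longrightarrow> r < 1 \<Longrightarrow> bij_betw (h r) (basis r) (basis (- r))"
    by metis
  define J where "J = (\<Union>r\<in>{0<..<1}. basis r)"
  define J' where "J' = (\<Union>r\<in>{0<..<1}. basis (- r))"
  have J'_h: "J' = (\<Union>r\<in>{0<..<1}. h r ` basis r)"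
    unfolding J'_def using h by (intro SUP_cong) (auto simp: bij_betw_def)
  have bases_eq: "bases = basis 1 \<union> basis (-1) \<union> J \<union> J'"
  proof
    show "bases \<subseteq> basis 1 \<union> basis (-1) \<union> J \<union> J'"
    proof
      fix e assume "e \<in> bases"
      then obtain r where r: "e \<in> basis r"
        by (auto simp: bases_def)
      consider "r = 1" | "r = - 1" | "0 < r" "r < 1" | "0 < - r" "- r < 1"
        using basis_le[OF r] basis_nz[OF r] by fastforce
      then show "e \<in> basis 1 \<union> basis (-1) \<union> J \<union> J'"
      proof cases
        case 4
        then have "e \<in> J'"
          unfolding J'_def using r by (intro UN_I[of "- r"]) auto
        then show ?thesis
          by blast
      qed (use r in \<open>auto simp: J_def\<close>)
    qed
  qed (auto simp: bases_def J_def J'_def)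
  \<comment> \<open>Only finitely many basis vectors have eigenvalue at least
    \<open>1 / Suc n\<close>, and these finite sets cover \<open>J\<close>.\<close>
  have "countable J"
  proof -
    have sub: "J \<subseteq> (\<Union>n. \<Union>r\<in>{1 / real (Suc n)..}. basis r)"
    proof
      fix e assume "e \<in> J"
      then obtain r where r: "0 < r" "e \<in> basis r"
        by (auto simp: J_def)
      obtain n where "1 / real (Suc n) < r"
        using r(1) nat_approx_posE by metis
      then show "e \<in> (\<Union>n. \<Union>r\<in>{1 / real (Suc n)..}. basis r)"
        using r(2) by (intro UN_I[of n] UN_I[of r]) auto
    qed
    have fin: "finite (\<Union>r\<in>{1 / real (Suc n)..}. basis r)" for n
    proof (rule finite_orthonormal_eigenvectors[OF compact, of _ "1 / real (Suc n)"])
      show "orthonormal_on (\<Union>r\<in>{1 / real (Suc n)..}. basis r) id"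
        using basis_cinner by (auto simp: orthonormal_on_def)
      fix e assume "e \<in> (\<Union>r\<in>{1 / real (Suc n)..}. basis r)"
      then obtain r where "1 / real (Suc n) \<le> r" "e \<in> basis r"
        by auto
      then show "\<exists>c. 1 / real (Suc n) \<le> cmod c \<and> T e = c *\<^sub>C e"
        by (intro exI[of _ "complex_of_real r"]) (simp add: basis_eig)
    qed simp
    show ?thesis
      by (rule countable_subset[OF sub]) (intro countable_UN countableI_type countable_finite[OF fin])
  qed
  obtain v where v: "\<And>e. e \<in> J \<Longrightarrow> 0 < v e \<and> v e < 1 \<and> e \<in> basis (v e)"
    unfolding J_def by (metis UN_E greaterThanLessThan_iff)
  \<comment> \<open>The bijections \<open>h r\<close> for the single eigenvalues are glued along the
    eigenvalue \<open>v e\<close> of \<open>e\<close>.\<close>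
  define \<sigma> where "\<sigma> e = h (v e) e" for e
  have \<sigma>_basis: "\<sigma> e \<in> basis (- v e)" if "e \<in> J" for e
    using h[of "v e"] v[OF that] by (auto simp: \<sigma>_def bij_betw_def)
  have \<sigma>: "bij_betw \<sigma> J J'"
    unfolding bij_betw_def
  proof
    show "inj_on \<sigma> J"
    proof (rule inj_onI)
      fix e f assume ef: "e \<in> J" "f \<in> J" "\<sigma> e = \<sigma> f"
      then have "v e = v f"
        using \<sigma>_basis basis_eigenvalue_unique by (metis neg_equal_iff_equal)
      with ef show "e = f"
        using h[of "v e"] v unfolding \<sigma>_def bij_betw_def by (metis inj_onD)
    qed
    have "\<sigma> e = h r e" if "0 < r" "r < 1" "e \<in> basis r" for e r
      using that v[of e] basis_eigenvalue_unique unfolding J_def \<sigma>_def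
      by (metis UN_I greaterThanLessThan_iff)
    then have "\<sigma> ` J = (\<Union>r\<in>{0<..<1}. h r ` basis r)"
      unfolding J_def image_UN by (intro SUP_cong) auto
    then show "\<sigma> ` J = J'"
      by (simp add: J'_h)
  qed
  \<comment> \<open>\<open>J'\<close> is as large as \<open>J\<close> and the eigenvalues
    \<open>1\<close> and \<open>- 1\<close> contribute finitely many vectors, whereas the whole
    basis is infinite.\<close>
  have "infinite J"
  proof
    assume "finite J"
    then have "finite bases"
      using bij_betw_finite[OF \<sigma>] finite_basis by (simp add: bases_eq)
    then show False
      using bases_infinite[OF inf] by blast
  qed
  then obtain ep where ep: "bij_betw ep (UNIV::nat set) J"
    using bij_betw_from_nat_into[OF \<open>countable J\<close>] by blast
  have ep_J: "ep j \<in> J" for j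
    using ep by (auto simp: bij_betw_def)
  define lam where "lam j = v (ep j)" for j
  have lam: "0 < lam j" "lam j < 1" "ep j \<in> basis (lam j)" "\<sigma> (ep j) \<in> basis (- lam j)" for j
    using v[OF ep_J] \<sigma>_basis[OF ep_J] by (auto simp: lam_def)
  define E where "E i = (case i of IU k \<Rightarrow> u k | IW k \<Rightarrow> w k | IP j \<Rightarrow> ep j | IM j \<Rightarrow> \<sigma> (ep j))" for i
  have uw: "k \<le> m \<Longrightarrow> u k \<in> basis 1" "k < m \<Longrightarrow> w k \<in> basis (-1)" for k
    using u w by (auto simp: bij_betw_def)
  \<comment> \<open>The eigenvalue of a label separates the four families. Within a family
    \<open>lam\<close> may repeat, and there injectivity comes from the enumerations.\<close>
  define \<nu> where "\<nu> i = (case i of IU k \<Rightarrow> 1 | IW k \<Rightarrow> - 1 | IP j \<Rightarrow> lam j | IM j \<Rightarrow> - lam j)" for i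
  have E_basis: "E i \<in> basis (\<nu> i)" if "i \<in> ixs m" for i
    using that uw lam by (cases i) (auto simp: E_def \<nu>_def)
  have E_inj: "inj_on E (ixs m)"
  proof (rule inj_onI)
    fix i j assume ij: "i \<in> ixs m" "j \<in> ixs m" "E i = E j"
    then have "\<nu> i = \<nu> j"
      using E_basis basis_eigenvalue_unique by metis
    moreover have "lam k \<noteq> - lam l" "lam k \<noteq> 1" "lam k \<noteq> - 1" "1 \<noteq> lam k" "- 1 \<noteq> lam k" "- lam k \<noteq> lam l" for k l
      using lam(1,2)[of k] lam(1,2)[of l] by linarith+
    moreover have "k = l" if "ep k = ep l" for k l
      using ep that by (auto simp: bij_betw_def inj_eq)
    moreover have "k = l" if "\<sigma> (ep k) = \<sigma> (ep l)" for k l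
      using ep that inj_onD[OF bij_betw_imp_inj_on[OF \<sigma>] _ ep_J ep_J] by (auto simp: bij_betw_def inj_eq)
    moreover have "k = l" if "u k = u l" "k \<le> m" "l \<le> m" for k l
      using u that by (auto simp: bij_betw_def inj_on_def)
    moreover have "k = l" if "w k = w l" "k < m" "l < m" for k l
      using w that by (auto simp: bij_betw_def inj_on_def)
    ultimately show "i = j"
      using ij by (cases i; cases j) (auto simp: E_def \<nu>_def)
  qed
  have "E ` ixs m = u ` {..m} \<union> w ` {..<m} \<union> range ep \<union> \<sigma> ` range ep"
    by (simp add: ixs_def image_Un image_image E_def)
  then have E_img: "E ` ixs m = bases"
    using u w ep \<sigma> by (simp add: bij_betw_def bases_eq)
  have "paired_eigenbasis T E lam m"
  proof
    show "cblinear T"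
      by (rule lin)
    show "orthonormal_on (ixs m) E"
      unfolding orthonormal_on_def using basis_cinner[OF E_basis E_basis] inj_on_eq_iff[OF E_inj] by simp
    show "total_on (ixs m) E"
      unfolding total_on_def using bases_total E_img by (metis imageE)
    show "0 < lam j" "lam j < 1" for j
      using lam by auto
    show "T (E (IU i)) = E (IU i)" if "i \<le> m" for i
      using basis_eig[OF uw(1)[OF that]] by (simp add: E_def)
    show "T (E (IW i)) = - E (IW i)" if "i < m" for i
      using basis_eig[OF uw(2)[OF that]] by (simp add: E_def scaleC_minus_left)
    show "T (E (IP j)) = complex_of_real (lam j) *\<^sub>C E (IP j)" for j
      using basis_eig[OF lam(3)] by (simp add: E_def)
    show "T (E (IM j)) = - (complex_of_real (lam j) *\<^sub>C E (IM j))" for j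
      using basis_eig[OF lam(4)] by (simp add: E_def scaleC_minus_left)
  qed
  then show ?thesis
    by blast
qed

section \<open>Change of sign and conclusion\<close>

lemma eigenspace_uminus: "eigenspace c (\<lambda>x. - T x) = eigenspace (- c) (T :: 'a::complex_vector \<Rightarrow> 'a)"
  by (auto simp: eigenspace_def scaleC_minus_left) (metis minus_minus)+

text \<open>Negation interchanges the eigenspaces of \<open>l\<close> and \<open>- l\<close>, and it
  is a homeomorphism, so the closed image of the ball stays compact.\<close>

lemma defect_form_uminus:
  fixes T :: "'a::chilbert_space \<Rightarrow> 'a"
  assumes "defect_form T"
  shows "defect_form (\<lambda>x. - T x)"
proof -
  have T: "compact_op T" "cadj T = T" "inj T" "\<And>x. norm (T x) \<le> norm x"
    and eig: "\<And>l::real. 0 < l \<Longrightarrow> l < 1 \<Longrightarrow>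
      (is_eigenvalue (complex_of_real l) T \<longleftrightarrow> is_eigenvalue (complex_of_real (- l)) T) \<and>
      cdim (eigenspace (complex_of_real l) T) = cdim (eigenspace (complex_of_real (- l)) T)"
    using assms unfolding defect_form_def by blast+
  have lin: "cblinear T"
    using T by (simp add: compact_op_def)
  then have "cblinear (\<lambda>x. - T x)"
    by (auto simp: cblinear_def clinear_def scaleC_minus_right)
  moreover have "compact (closure ((\<lambda>x. - T x) ` cball 0 1))"
  proof -
    have "closure ((\<lambda>x. - T x) ` cball 0 1) = uminus ` closure (T ` cball 0 1)"
      using closure_scaleR[of "- 1" "T ` cball 0 1"] by (simp add: image_image)
    then show ?thesis
      using T(1) by (simp add: compact_op_def compact_negations)
  qed
  moreover have "cadj (\<lambda>x. - T x) = (\<lambda>x. - T x)"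
    using adjoint_exists[OF lin] T(2) by (intro cadj_eqI) (simp add: cinner_simps)
  moreover have "inj (\<lambda>x. - T x)"
    using T(3) by (simp add: inj_def)
  ultimately show ?thesis
    using T(4) eig unfolding defect_form_def compact_op_def is_eigenvalue_def eigenspace_uminus by simp
qed

lemma exists_irreducible_pair:
  fixes T :: "'a::chilbert_space \<Rightarrow> 'a"
  assumes "cdim (UNIV :: 'a set) = \<infinity>" "defect_form T" "cdim (eigenspace 1 T) = cdim (eigenspace (-1) T) + 1"
  shows "\<exists>U P. unitary_op U \<and> cprojection P \<and> no_common_reducing U P \<and>
           (\<forall>x. (x - P x) - U (cadj U x - P (cadj U x)) = T x)"
proof -
  obtain E lam m where "paired_eigenbasis T E lam m"
    using exists_paired_eigenbasis[OF assms] by blast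
  then show ?thesis
    by (rule paired_eigenbasis.exists_irreducible)
qed

lemma reducing_subspace_complement:
  assumes "reducing_subspace M (\<lambda>x. x - P x)"
  shows "reducing_subspace M P"
proof -
  have "P x \<in> N" if "N = M \<or> N = corth M" "x \<in> N" for x N
  proof -
    have N: "csubspace N" and "x - P x \<in> N"
      using assms that csubspace_corth by (auto simp: reducing_subspace_def)
    then have "x - (x - P x) \<in> N"
      using that csubspace_diff by blast
    then show ?thesis
      by simp
  qed
  then show ?thesis
    using assms unfolding reducing_subspace_def by blast
qed

text \<open>The second alternative is the first one for \<open>- T\<close>: passing from \<open>P\<close> to its complement changes the
  sign of the defect operator.\<close>

theorem theorem4p2:
  fixes T :: "'a::chilbert_space \<Rightarrow> 'a"
  assumes "cdim (UNIV :: 'a set) = \<infinity>"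
    and "defect_form T"
    and "cdim (eigenspace 1 T) = cdim (eigenspace (-1) T) + 1 \<or>
         cdim (eigenspace (-1) T) = cdim (eigenspace 1 T) + 1"
  shows "\<exists>U P. unitary_op U \<and> cprojection P \<and> no_common_reducing U P \<and>
           (\<forall>x. (x - P x) - U (cadj U x - P (cadj U x)) = T x)"
  using assms(3)
proof
  assume "cdim (eigenspace 1 T) = cdim (eigenspace (-1) T) + 1"
  then show ?thesis
    by (rule exists_irreducible_pair[OF assms(1,2)])
next
  assume "cdim (eigenspace (-1) T) = cdim (eigenspace 1 T) + 1"
  then have "cdim (eigenspace 1 (\<lambda>x. - T x)) = cdim (eigenspace (-1) (\<lambda>x. - T x)) + 1"
    by (simp add: eigenspace_uminus)
  then obtain U P where U: "unitary_op U" and P: "cprojection P" and irr: "no_common_reducing U P"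
    and eq: "\<And>x. (x - P x) - U (cadj U x - P (cadj U x)) = - T x"
    using exists_irreducible_pair[OF assms(1) defect_form_uminus[OF assms(2)]] by blast
  have lin: "cblinear U" and UU: "U (cadj U x) = x" for x
    using U by (auto simp: unitary_op_def fun_eq_iff)
  show ?thesis
  proof (rule exI[of _ U], rule exI[of _ "\<lambda>x. x - P x"], intro conjI allI)
    show "cprojection (\<lambda>x. x - P x)"
      by (rule cprojection_complement[OF P])
    show "no_common_reducing U (\<lambda>x. x - P x)"
      using irr reducing_subspace_complement unfolding no_common_reducing_def by blast
    \<comment> \<open>As \<open>U (cadj U x) = x\<close>, the identity contributes nothing to the
      defect, so replacing \<open>P\<close> by its complement only flips the sign.\<close>
    show "x - (x - P x) - U (cadj U x - (cadj U x - P (cadj U x))) = T x" for x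
      using eq[of x] by (simp add: cblinear_diff[OF lin] UU algebra_simps)
  qed (rule U)
qed

end
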